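(* Let $k$ be a commutative ring with $\frac12\in k$, let $(A,1)$ be a graded $k$-module with split element, and let $\mu_{\mathrm{su}}\in CC^\bullet(A,A)_{-1}$ be the trivial strictly unital $A_\infty$-algebra structure. Then the submodule $CC^\bullet(\overline A,A)\subseteq CC^\bullet(A,A)$ is a graded Lie subalgebra of $CC^\bullet(A,A)$ (with the Gerstenhaber bracket), and the derivation $[\mu_{\mathrm{su}},-]$ of $CC^\bullet(A,A)$ preserves $CC^\bullet(\overline A,A)$. The Maurer-Cartan elements of the resulting dg-Lie algebra $(CC^\bullet(\overline A,A),[\mu_{\mathrm{su}},-])$ correspond bijectively to the strictly unital $A_\infty$-algebra structures on $(A,1)$ via $$\overline\mu+h\;\longmapsto\;\overline\mu+h+\mu_{\mathrm{su}},$$ where $\overline\mu+h\in CC^\bullet(\overline A,\overline A)_{-1}\oplus CC^\bullet(\overline A,k)_{-1}=CC^\bullet(\overline A,A)_{-1}$.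
   Context: Conventions: $k$ is a commutative ring; modules, maps, tensor products are over $k$; graded means $\mathbb Z$-graded without boundedness assumptions. $\mathrm{Hom}(M,N)_n=\prod_i\mathrm{Hom}(M_i,N_{i+n})$. $(\Pi M)_n=M_{n-1}$, $s:M\to\Pi M$ is the degree $1$ identity map, $[x]=s(x)$, $[x_1|\dots|x_n]=[x_1]\otimes\dots\otimes[x_n]$. Koszul sign rule: $(f\otimes g)(x\otimes y)=(-1)^{|g||x|}f(x)\otimes g(y)$. $CC^n(A,B)=\mathrm{Hom}((\Pi A)^{\otimes n},\Pi B)$ and $CC^\bullet(A,B)=\prod_{n\ge1}CC^n(A,B)$, with elements $f=(f^n)$; $CC^\bullet(A,B)_i$ is the degree $i$ part. For $g\in CC^\bullet(A,B)$, $f\in CC^\bullet(A,A)$ the Gerstenhaber product is $(g\circ f)^n=\sum_{i=1}^n\sum_{j=0}^{i-1}g^i(1^{\otimes j}\otimes f^{n-i+1}\otimes1^{\otimes i-j-1})$. The Gerstenhaber bracket on $CC^\bullet(A,A)$ is $[f,g]=f\circ g-(-1)^{|f||g|}g\circ f$, a graded Lie algebra structure. A (nonunital) $A_\infty$-algebra structure on $A$ is $\nu\in CC^\bullet(A,A)_{-1}$ with $\nu\circ\nu=0$. Given $1\in A_0$, $\nu\in CC^\bullet(A,A)_{-1}$ is strictly unital if $\nu^2[1|a]=[a]=(-1)^{|a|}\nu^2[a|1]$ for all $a\in A$, and for $n\ne2$, $\nu^n$ vanishes on every $[a_1|\dots|a_n]$ in which some $a_i=1$. A strictly unital $A_\infty$-algebra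 structure is a strictly unital $\nu$ with $\nu\circ\nu=0$. A graded module with split element is a pair $(A,1)$, where $1\in A_0$ generates a free rank one submodule, together with a fixed graded splitting $A\to k$ of the inclusion $k\to A$, $1\mapsto1$. Put $\overline A=A/(k\cdot1)$, regarded as a submodule of $A$ via the splitting, so $A=\overline A\oplus k$. $CC^\bullet(\overline A,A)$ is regarded as a submodule of $CC^\bullet(A,A)$ via the projection $A\to\overline A$ (extension by zero to tensors having an entry $[1]$), and $CC^\bullet(\overline A,A)=CC^\bullet(\overline A,\overline A)\oplus CC^\bullet(\overline A,k)$. The trivial structure $\mu_{\mathrm{su}}$ has $\mu_{\mathrm{su}}^n=0$ for $n\neq2$, $\mu_{\mathrm{su}}^2[1|a]=[a]$ and $\mu_{\mathrm{su}}^2[a|1]=(-1)^{|a|}[a]$ for $a\in A$, and $\mu^2_{\mathrm{su}}=0$ on $\Pi\overline A\otimes\Pi\overline A$; it is a strictly unital $A_\infty$-structure. The Maurer-Cartan elements of a dg-Lie algebra $(L,\delta)$ (with $\delta$ of degree $-1$) are $\{v\in L_{-1}: \delta(v)+\frac12[v,v]=0\}$. *)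

theory Defs
  imports Complex_Main "HOL-Library.Function_Algebras"
begin

section \<open>Graded modules\<close>

text \<open>
  A \<open>\<int>\<close>-graded module is a family of submodules \<open>M i\<close> of some ambient module; there is no
  boundedness assumption, and only homogeneous elements ever occur. Nothing relates the \<open>M i\<close>
  inside the ambient module, and every graded module arises in this way up to isomorphism (take
  its total direct sum as the ambient module).
\<close>

definition graded_module ::
  "('k::comm_ring_1 \<Rightarrow> 'a::ab_group_add \<Rightarrow> 'a) \<Rightarrow> (int \<Rightarrow> 'a set) \<Rightarrow> bool" where
  "graded_module s M \<longleftrightarrow> module s \<and> (\<forall>i. module.subspace s (M i))"

definition graded_submodule ::
  "('k::comm_ring_1 \<Rightarrow> 'a::ab_group_add \<Rightarrow> 'a) \<Rightarrow> (int \<Rightarrow> 'a set) \<Rightarrow> (int \<Rightarrow> 'a set) \<Rightarrow> bool" where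
  "graded_submodule s N M \<longleftrightarrow> graded_module s N \<and> (\<forall>i. N i \<subseteq> M i)"

text \<open>Homogeneous maps of degree \<open>p\<close>: the elements of \<open>\<Prod>\<^sub>i Hom(M\<^sub>i, N\<^bsub>i+p\<^esub>)\<close>.\<close>

definition graded_hom ::
  "('k::comm_ring_1 \<Rightarrow> 'a::ab_group_add \<Rightarrow> 'a) \<Rightarrow> ('k \<Rightarrow> 'b::ab_group_add \<Rightarrow> 'b) \<Rightarrow>
   (int \<Rightarrow> 'a set) \<Rightarrow> (int \<Rightarrow> 'b set) \<Rightarrow> int \<Rightarrow> (int \<Rightarrow> 'a \<Rightarrow> 'b) \<Rightarrow> bool" where
  "graded_hom s t M N p \<phi> \<longleftrightarrow>
     (\<forall>i. \<forall>x\<in>M i. \<phi> i x \<in> N (i + p)) \<and>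
     (\<forall>i. \<forall>x\<in>M i. \<forall>y\<in>M i. \<phi> i (x + y) = \<phi> i x + \<phi> i y) \<and>
     (\<forall>i c. \<forall>x\<in>M i. \<phi> i (s c x) = t c (\<phi> i x))"

definition suspension :: "(int \<Rightarrow> 'a set) \<Rightarrow> int \<Rightarrow> 'a set" where
  "suspension M n = M (n - 1)"

definition base_ring :: "int \<Rightarrow> 'k::comm_ring_1 set" where
  "base_ring i = (if i = 0 then UNIV else {0})"

definition koszul_sign :: "int \<Rightarrow> 'a::ab_group_add \<Rightarrow> 'a" where
  "koszul_sign n x = (if even n then x else - x)"


section \<open>Maps out of tensor powers\<close>

text \<open>
  The pair \<open>(d, x)\<close> is a homogeneous element \<open>x\<close> of degree \<open>d\<close>, and the word
  \<open>[(d\<^sub>1, x\<^sub>1), \<dots>, (d\<^sub>n, x\<^sub>n)]\<close> is the pure tensor \<open>x\<^sub>1 \<otimes> \<dots> \<otimes> x\<^sub>n\<close>. By the universal property of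
  tensor products, a \<open>k\<close>-linear map of degree \<open>p\<close> from \<open>M\<^sup>\<otimes>\<^sup>n\<close> to \<open>N\<close> is the same thing as a
  function on words of length \<open>n\<close> that is linear in every entry and raises degree by \<open>p\<close>.
  Functions are set to \<open>0\<close> outside the words over \<open>M\<close>, so that equality of functions is
  equality of maps.
\<close>

type_synonym 'a hword = "(int \<times> 'a) list"

definition hwords :: "(int \<Rightarrow> 'a set) \<Rightarrow> nat \<Rightarrow> 'a hword set" where
  "hwords M n = {w. length w = n \<and> (\<forall>(d, x)\<in>set w. x \<in> M d)}"

definition wdeg :: "'a hword \<Rightarrow> int" where
  "wdeg w = sum_list (map fst w)"

definition tensor_hom ::
  "('k::comm_ring_1 \<Rightarrow> 'a::ab_group_add \<Rightarrow> 'a) \<Rightarrow> ('k \<Rightarrow> 'b::ab_group_add \<Rightarrow> 'b) \<Rightarrow>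
   (int \<Rightarrow> 'a set) \<Rightarrow> (int \<Rightarrow> 'b set) \<Rightarrow> nat \<Rightarrow> int \<Rightarrow> ('a hword \<Rightarrow> 'b) set" where
  "tensor_hom s t M N n p = {f.
     (\<forall>w. w \<notin> hwords M n \<longrightarrow> f w = 0) \<and>
     (\<forall>w\<in>hwords M n. f w \<in> N (wdeg w + p)) \<and>
     (\<forall>u v d x y. u @ (d, x) # v \<in> hwords M n \<longrightarrow> u @ (d, y) # v \<in> hwords M n \<longrightarrow>
        f (u @ (d, x + y) # v) = f (u @ (d, x) # v) + f (u @ (d, y) # v)) \<and>
     (\<forall>u v d x c. u @ (d, x) # v \<in> hwords M n \<longrightarrow>
        f (u @ (d, s c x) # v) = t c (f (u @ (d, x) # v)))}"


section \<open>The complex \<open>CC\<close> and the Gerstenhaber bracket\<close>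

text \<open>
  Arguments and values of cochains live in the suspensions: the element \<open>[a]\<close> with \<open>|a| = d\<close> is
  the pair \<open>(d + 1, a)\<close>. The product over \<open>n \<ge> 1\<close> is encoded by letting the arity \<open>0\<close> part
  vanish; \<open>CC s t A B p\<close> is the degree \<open>p\<close> part.
\<close>

type_synonym ('a, 'b) cochain = "nat \<Rightarrow> 'a hword \<Rightarrow> 'b"

definition CC ::
  "('k::comm_ring_1 \<Rightarrow> 'a::ab_group_add \<Rightarrow> 'a) \<Rightarrow> ('k \<Rightarrow> 'b::ab_group_add \<Rightarrow> 'b) \<Rightarrow>
   (int \<Rightarrow> 'a set) \<Rightarrow> (int \<Rightarrow> 'b set) \<Rightarrow> int \<Rightarrow> ('a, 'b) cochain set" where
  "CC s t A B p = {f. f 0 = 0 \<and>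
     (\<forall>n\<ge>1. f n \<in> tensor_hom s t (suspension A) (suspension B) n p)}"

definition cc_scale :: "('k \<Rightarrow> 'b \<Rightarrow> 'b) \<Rightarrow> 'k \<Rightarrow> ('a, 'b) cochain \<Rightarrow> ('a, 'b) cochain" where
  "cc_scale t c f = (\<lambda>n w. t c (f n w))"

text \<open>
  \<open>insert_map p f m j w\<close> is the word obtained from \<open>w\<close> by applying
  \<open>1\<^sup>\<otimes>\<^sup>j \<otimes> f\<^sup>m \<otimes> 1 \<otimes> \<dots> \<otimes> 1\<close> with \<open>f\<close> of degree \<open>p\<close>, up to the Koszul sign, which comes from moving
  \<open>f\<close> past the first \<open>j\<close> entries and appears in \<open>gerst\<close>.
\<close>

definition insert_map :: "int \<Rightarrow> ('a, 'a) cochain \<Rightarrow> nat \<Rightarrow> nat \<Rightarrow> 'a hword \<Rightarrow> 'a hword" where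
  "insert_map p f m j w =
     (let v = take m (drop j w)
      in take j w @ (wdeg v + p, f m v) # drop (j + m) w)"

text \<open>The Gerstenhaber product \<open>g \<circ> f\<close> for \<open>f\<close> of degree \<open>p\<close>.\<close>

definition gerst ::
  "int \<Rightarrow> ('a, 'b::ab_group_add) cochain \<Rightarrow> ('a, 'a) cochain \<Rightarrow> ('a, 'b) cochain" where
  "gerst p g f n w =
     (\<Sum>i = 1..n. \<Sum>j = 0..i - 1.
        koszul_sign (p * wdeg (take j w)) (g i (insert_map p f (n - i + 1) j w)))"

text \<open>The bracket \<open>[f, g]\<close> of \<open>f\<close> of degree \<open>p\<close> and \<open>g\<close> of degree \<open>q\<close>.\<close>

definition gbracket ::
  "int \<Rightarrow> int \<Rightarrow> ('a::ab_group_add, 'a) cochain \<Rightarrow> ('a, 'a) cochain \<Rightarrow> ('a, 'a) cochain" where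
  "gbracket p q f g = gerst q f g - koszul_sign (p * q) (gerst p g f)"


section \<open>Graded Lie algebras\<close>

text \<open>
  A bracket is a family \<open>br p q\<close> of operations on elements of degrees \<open>p\<close> and \<open>q\<close>. The last two
  conditions follow from the others when \<open>2\<close> and \<open>3\<close> are invertible; over general rings they
  belong to the definition.
\<close>

definition graded_lie_algebra ::
  "('k::comm_ring_1 \<Rightarrow> 'l::ab_group_add \<Rightarrow> 'l) \<Rightarrow> (int \<Rightarrow> 'l set) \<Rightarrow>
   (int \<Rightarrow> int \<Rightarrow> 'l \<Rightarrow> 'l \<Rightarrow> 'l) \<Rightarrow> bool" where
  "graded_lie_algebra s L br \<longleftrightarrow>
     graded_module s L \<and>
     (\<forall>p q. \<forall>x\<in>L p. \<forall>y\<in>L q. br p q x y \<in> L (p + q)) \<and>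
     (\<forall>p q. \<forall>x\<in>L p. \<forall>x'\<in>L p. \<forall>y\<in>L q. br p q (x + x') y = br p q x y + br p q x' y) \<and>
     (\<forall>p q. \<forall>x\<in>L p. \<forall>y\<in>L q. \<forall>y'\<in>L q. br p q x (y + y') = br p q x y + br p q x y') \<and>
     (\<forall>p q c. \<forall>x\<in>L p. \<forall>y\<in>L q. br p q (s c x) y = s c (br p q x y)) \<and>
     (\<forall>p q c. \<forall>x\<in>L p. \<forall>y\<in>L q. br p q x (s c y) = s c (br p q x y)) \<and>
     (\<forall>p q. \<forall>x\<in>L p. \<forall>y\<in>L q. br p q x y = - koszul_sign (p * q) (br q p y x)) \<and>
     (\<forall>p q r. \<forall>x\<in>L p. \<forall>y\<in>L q. \<forall>z\<in>L r.
        br p (q + r) x (br q r y z) =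
          br (p + q) r (br p q x y) z + koszul_sign (p * q) (br q (p + r) y (br p r x z))) \<and>
     (\<forall>p. even p \<longrightarrow> (\<forall>x\<in>L p. br p p x x = 0)) \<and>
     (\<forall>p. odd p \<longrightarrow> (\<forall>x\<in>L p. br p (p + p) x (br p p x x) = 0))"

definition graded_lie_subalgebra ::
  "('k::comm_ring_1 \<Rightarrow> 'l::ab_group_add \<Rightarrow> 'l) \<Rightarrow> (int \<Rightarrow> 'l set) \<Rightarrow> (int \<Rightarrow> 'l set) \<Rightarrow>
   (int \<Rightarrow> int \<Rightarrow> 'l \<Rightarrow> 'l \<Rightarrow> 'l) \<Rightarrow> bool" where
  "graded_lie_subalgebra s K L br \<longleftrightarrow>
     graded_lie_algebra s L br \<and>
     graded_submodule s K L \<and>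
     (\<forall>p q. \<forall>x\<in>K p. \<forall>y\<in>K q. br p q x y \<in> K (p + q))"

text \<open>\<open>\<delta> p\<close> is the component of the derivation on elements of degree \<open>p\<close>.\<close>

definition graded_derivation ::
  "('k::comm_ring_1 \<Rightarrow> 'l::ab_group_add \<Rightarrow> 'l) \<Rightarrow> (int \<Rightarrow> 'l set) \<Rightarrow>
   (int \<Rightarrow> int \<Rightarrow> 'l \<Rightarrow> 'l \<Rightarrow> 'l) \<Rightarrow> int \<Rightarrow> (int \<Rightarrow> 'l \<Rightarrow> 'l) \<Rightarrow> bool" where
  "graded_derivation s L br r \<delta> \<longleftrightarrow>
     graded_hom s s L L r \<delta> \<and>
     (\<forall>p q. \<forall>x\<in>L p. \<forall>y\<in>L q.
        \<delta> (p + q) (br p q x y) =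
          br (p + r) q (\<delta> p x) y + koszul_sign (r * p) (br p (q + r) x (\<delta> q y)))"

definition dg_lie_algebra ::
  "('k::comm_ring_1 \<Rightarrow> 'l::ab_group_add \<Rightarrow> 'l) \<Rightarrow> (int \<Rightarrow> 'l set) \<Rightarrow>
   (int \<Rightarrow> int \<Rightarrow> 'l \<Rightarrow> 'l \<Rightarrow> 'l) \<Rightarrow> (int \<Rightarrow> 'l \<Rightarrow> 'l) \<Rightarrow> bool" where
  "dg_lie_algebra s L br \<delta> \<longleftrightarrow>
     graded_lie_algebra s L br \<and>
     graded_derivation s L br (-1) \<delta> \<and>
     (\<forall>p. \<forall>x\<in>L p. \<delta> (p - 1) (\<delta> p x) = 0)"

text \<open>The parameter \<open>half\<close> is meant to be the element \<open>1/2\<close> of the base ring.\<close>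

definition maurer_cartan ::
  "('k::comm_ring_1 \<Rightarrow> 'l::ab_group_add \<Rightarrow> 'l) \<Rightarrow> 'k \<Rightarrow> (int \<Rightarrow> 'l set) \<Rightarrow>
   (int \<Rightarrow> int \<Rightarrow> 'l \<Rightarrow> 'l \<Rightarrow> 'l) \<Rightarrow> (int \<Rightarrow> 'l \<Rightarrow> 'l) \<Rightarrow> 'l set" where
  "maurer_cartan s half L br \<delta> =
     {v \<in> L (-1). \<delta> (-1) v + s half (br (-1) (-1) v v) = 0}"


section \<open>Strictly unital \<open>A\<^sub>\<infinity>\<close>-algebras\<close>

definition strictly_unital :: "(int \<Rightarrow> 'a::ab_group_add set) \<Rightarrow> 'a \<Rightarrow> ('a, 'a) cochain \<Rightarrow> bool" where
  "strictly_unital A one \<nu> \<longleftrightarrow>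
     (\<forall>d. \<forall>a\<in>A d. \<nu> 2 [(1, one), (d + 1, a)] = a \<and>
        koszul_sign d (\<nu> 2 [(d + 1, a), (1, one)]) = a) \<and>
     (\<forall>n w. n \<noteq> 2 \<longrightarrow> w \<in> hwords (suspension A) n \<longrightarrow> (1, one) \<in> set w \<longrightarrow> \<nu> n w = 0)"

definition strictly_unital_ainf ::
  "('k::comm_ring_1 \<Rightarrow> 'a::ab_group_add \<Rightarrow> 'a) \<Rightarrow> (int \<Rightarrow> 'a set) \<Rightarrow> 'a \<Rightarrow> ('a, 'a) cochain set" where
  "strictly_unital_ainf s A one =
     {\<nu> \<in> CC s s A A (-1). strictly_unital A one \<nu> \<and> gerst (-1) \<nu> \<nu> = 0}"

text \<open>\<open>\<epsilon>\<close> is the splitting \<open>A \<rightarrow> k\<close>, where \<open>k\<close> sits in degree \<open>0\<close>.\<close>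

definition split_element ::
  "('k::comm_ring_1 \<Rightarrow> 'a::ab_group_add \<Rightarrow> 'a) \<Rightarrow> (int \<Rightarrow> 'a set) \<Rightarrow> 'a \<Rightarrow>
   (int \<Rightarrow> 'a \<Rightarrow> 'k) \<Rightarrow> bool" where
  "split_element s A one \<epsilon> \<longleftrightarrow>
     graded_module s A \<and> one \<in> A 0 \<and> (\<forall>c. s c one = 0 \<longrightarrow> c = 0) \<and>
     graded_hom s (*) A base_ring 0 \<epsilon> \<and> \<epsilon> 0 one = 1"

text \<open>\<open>A / (k \<cdot> 1)\<close>, regarded as a submodule of \<open>A\<close> via the splitting.\<close>

definition reduced :: "(int \<Rightarrow> 'a set) \<Rightarrow> (int \<Rightarrow> 'a \<Rightarrow> 'k::comm_ring_1) \<Rightarrow> int \<Rightarrow> 'a set" where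
  "reduced A \<epsilon> i = {x \<in> A i. \<epsilon> i x = 0}"

definition unit_submodule ::
  "('k::comm_ring_1 \<Rightarrow> 'a::ab_group_add \<Rightarrow> 'a) \<Rightarrow> 'a \<Rightarrow> int \<Rightarrow> 'a set" where
  "unit_submodule s one i = (if i = 0 then range (\<lambda>c. s c one) else {0})"

definition proj_reduced ::
  "('k::comm_ring_1 \<Rightarrow> 'a::ab_group_add \<Rightarrow> 'a) \<Rightarrow> 'a \<Rightarrow> (int \<Rightarrow> 'a \<Rightarrow> 'k) \<Rightarrow> int \<Rightarrow> 'a \<Rightarrow> 'a" where
  "proj_reduced s one \<epsilon> i x = x - s (\<epsilon> i x) one"

text \<open>
  Pullback of cochains along the projection from \<open>A\<close> to the reduced part. An entry of degree \<open>d\<close>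
  in a word over the suspension has degree \<open>d - 1\<close> in \<open>A\<close>.
\<close>

definition extend_cochain ::
  "('k::comm_ring_1 \<Rightarrow> 'a::ab_group_add \<Rightarrow> 'a) \<Rightarrow> (int \<Rightarrow> 'a set) \<Rightarrow> 'a \<Rightarrow> (int \<Rightarrow> 'a \<Rightarrow> 'k) \<Rightarrow>
   ('a, 'a) cochain \<Rightarrow> ('a, 'a) cochain" where
  "extend_cochain s A one \<epsilon> f n w =
     (if w \<in> hwords (suspension A) n
      then f n (map (\<lambda>(d, x). (d, proj_reduced s one \<epsilon> (d - 1) x)) w) else 0)"

text \<open>For a graded submodule \<open>B\<close> of \<open>A\<close>: the cochains on the reduced part with values in \<open>B\<close>, as
  elements of \<open>CC(A, A)\<close>.\<close>

definition CC_reduced ::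
  "('k::comm_ring_1 \<Rightarrow> 'a::ab_group_add \<Rightarrow> 'a) \<Rightarrow> (int \<Rightarrow> 'a set) \<Rightarrow> 'a \<Rightarrow> (int \<Rightarrow> 'a \<Rightarrow> 'k) \<Rightarrow>
   (int \<Rightarrow> 'a set) \<Rightarrow> int \<Rightarrow> ('a, 'a) cochain set" where
  "CC_reduced s A one \<epsilon> B p = extend_cochain s A one \<epsilon> ` CC s s (reduced A \<epsilon>) B p"

text \<open>
  The trivial strictly unital structure, in one formula: with \<open>a = a' + \<epsilon>(a) 1\<close> and
  \<open>b = b' + \<epsilon>(b) 1\<close>, bilinearity and vanishing on \<open>[a'|b']\<close> give
  \<open>[a|b] \<mapsto> \<epsilon>(a) [b] + (-1)\<^bsup>|a|\<^esup> \<epsilon>(b) [a']\<close>. The lemmas below recover the defining properties.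
\<close>

definition mu_su ::
  "('k::comm_ring_1 \<Rightarrow> 'a::ab_group_add \<Rightarrow> 'a) \<Rightarrow> (int \<Rightarrow> 'a set) \<Rightarrow> 'a \<Rightarrow> (int \<Rightarrow> 'a \<Rightarrow> 'k) \<Rightarrow>
   ('a, 'a) cochain" where
  "mu_su s A one \<epsilon> n w =
     (if n = 2 \<and> w \<in> hwords (suspension A) 2 then
        (let d = fst (w ! 0) - 1; a = snd (w ! 0); e = fst (w ! 1) - 1; b = snd (w ! 1)
         in s (\<epsilon> d a) b + koszul_sign d (s (\<epsilon> e b) (proj_reduced s one \<epsilon> d a)))
      else 0)"

lemma hwords_2:
  "[(d, a), (e, b)] \<in> hwords (suspension A) 2 \<longleftrightarrow> a \<in> A (d - 1) \<and> b \<in> A (e - 1)"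
  by (simp add: hwords_def suspension_def)

lemma split_element_eps_0:
  assumes "split_element s A one \<epsilon>" "x \<in> A d" "d \<noteq> 0"
  shows "\<epsilon> d x = 0"
  using assms unfolding split_element_def graded_hom_def base_ring_def by force

lemma mu_su_other_arity: "n \<noteq> 2 \<Longrightarrow> mu_su s A one \<epsilon> n = 0"
  by (simp add: mu_su_def fun_eq_iff)

lemma mu_su_unit_left:
  assumes "split_element s A one \<epsilon>" "a \<in> A d"
  shows "mu_su s A one \<epsilon> 2 [(1, one), (d + 1, a)] = a"
proof -
  interpret module s using assms unfolding split_element_def graded_module_def by blast
  have "\<epsilon> 0 one = 1" "one \<in> A 0" using assms unfolding split_element_def by auto
  then show ?thesis
    using assms by (simp add: mu_su_def hwords_2 koszul_sign_def proj_reduced_def)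
qed

lemma mu_su_unit_right:
  assumes "split_element s A one \<epsilon>" "a \<in> A d"
  shows "mu_su s A one \<epsilon> 2 [(d + 1, a), (1, one)] = koszul_sign d a"
proof -
  interpret module s using assms unfolding split_element_def graded_module_def by blast
  have "\<epsilon> 0 one = 1" "one \<in> A 0" using assms unfolding split_element_def by auto
  then show ?thesis
    using assms split_element_eps_0[OF assms]
    by (cases "d = 0") (simp_all add: mu_su_def hwords_2 koszul_sign_def proj_reduced_def)
qed

lemma mu_su_reduced:
  assumes "split_element s A one \<epsilon>" "a \<in> reduced A \<epsilon> d" "b \<in> reduced A \<epsilon> e"
  shows "mu_su s A one \<epsilon> 2 [(d + 1, a), (e + 1, b)] = 0"
proof -
  interpret module s using assms unfolding split_element_def graded_module_def by blast
  show ?thesis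
    using assms by (simp add: mu_su_def hwords_2 koszul_sign_def reduced_def)
qed

text \<open>Restricting the pullback to the reduced part gives back the cochain, so the pullback is an
  embedding.\<close>

lemma extend_cochain_reduced:
  assumes "split_element s A one \<epsilon>" "w \<in> hwords (suspension (reduced A \<epsilon>)) n"
  shows "extend_cochain s A one \<epsilon> f n w = f n w"
proof -
  interpret module s using assms unfolding split_element_def graded_module_def by blast
  have "map (\<lambda>(d, x). (d, proj_reduced s one \<epsilon> (d - 1) x)) w = w"
    using assms(2)
    by (intro map_idI) (auto simp: hwords_def suspension_def reduced_def proj_reduced_def)
  moreover have "w \<in> hwords (suspension A) n"
    using assms(2) by (auto simp: hwords_def suspension_def reduced_def)
  ultimately show ?thesis by (simp add: extend_cochain_def)
qed

end

theory Submission
  imports Defs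
begin

text \<open>
  Evaluated on a word, \<open>g \<circ> f\<close> is the sum over all deconcatenations \<open>w = u v t\<close> of
  \<open>\<plusminus> g(u \<otimes> f(v) \<otimes> t)\<close>. Coassociativity of deconcatenation shows that the associator of this
  product consists of the terms with two disjoint insertions, so it is graded symmetric in its last
  two arguments; this pre-Lie identity gives the Jacobi identity.

  The cochains on the reduced part are those that vanish on every word with an entry \<open>[1]\<close>, and
  \<open>\<nu>\<close> is strictly unital exactly when \<open>\<nu> - \<mu>\<^sub>s\<^sub>u\<close> is such a cochain. On a word \<open>u \<otimes> [1] \<otimes> t\<close> the
  terms of \<open>[\<mu>\<^sub>s\<^sub>u, f]\<close> that survive cancel in pairs, so \<open>[\<mu>\<^sub>s\<^sub>u, -]\<close> preserves these cochains.
  Since \<open>\<mu>\<^sub>s\<^sub>u \<circ> \<mu>\<^sub>s\<^sub>u = 0\<close>, the Maurer-Cartan equation for \<open>v\<close> is the equation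
  \<open>(v + \<mu>\<^sub>s\<^sub>u) \<circ> (v + \<mu>\<^sub>s\<^sub>u) = 0\<close>.
\<close>

section \<open>Sums over deconcatenations\<close>

text \<open>The double sum defining \<open>gerst\<close> runs over arities and positions, and
  iterating it gives index sums that are hard to compare. Summing over the blocks themselves, empty
  ones included, leaves one recurring question: does a marked entry lie left of, inside or right of
  the inserted block? The answer, \<open>circ_append_Cons\<close>, serves three times: for the entry
  that varies (multilinearity), for the value of an inner cochain (the associator), and for the unit
  [1] (stability of the reduced cochains under the differential). Cochains are additive only in
  homogeneous entries and vanish off the words over the module. Identities are therefore proved on
  genuine words, and elsewhere both sides are 0. The element 1/2 enters twice: it turns [v, v] = 2
  (v \<circ> v) into v \<circ> v, and it passes from twice the square of the differential being 0 to
  the square being 0.\<close>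

definition cut_sum :: "('w list \<Rightarrow> 'w list \<Rightarrow> 'b::comm_monoid_add) \<Rightarrow> 'w list \<Rightarrow> 'b" where
  "cut_sum F w = (\<Sum>j\<le>length w. F (take j w) (drop j w))"

lemma cut_sum_Nil [simp]: "cut_sum F [] = F [] []"
  by (simp add: cut_sum_def)

lemma cut_sum_Cons [simp]:
  "cut_sum F (x # w) = F [] (x # w) + cut_sum (\<lambda>u v. F (x # u) v) w"
  by (simp add: cut_sum_def sum.atMost_Suc_shift del: sum.atMost_Suc)

lemma cut_sum_cong:
  assumes "\<And>u v. w = u @ v \<Longrightarrow> F u v = G u v"
  shows "cut_sum F w = cut_sum G w"
  unfolding cut_sum_def by (intro sum.cong refl assms) simp

lemma cut_sum_eq_0:
  assumes "\<And>u v. w = u @ v \<Longrightarrow> F u v = 0"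
  shows "cut_sum F w = 0"
  unfolding cut_sum_def by (intro sum.neutral ballI assms) simp

lemma cut_sum_add: "cut_sum (\<lambda>u v. F u v + G u v) w = cut_sum F w + cut_sum G w"
  by (simp add: cut_sum_def sum.distrib)

lemma cut_sum_swap:
  "cut_sum (\<lambda>a b. cut_sum (F a b) w) u = cut_sum (\<lambda>c d. cut_sum (\<lambda>a b. F a b c d) u) w"
  unfolding cut_sum_def by (rule sum.swap)

text \<open>A cut passes either left or right of the marked entry \<open>x\<close>; the cut just
  before \<open>x\<close> is the one with \<open>b = []\<close>, the cut just after it the one with
  \<open>c = []\<close>.\<close>

lemma cut_sum_append_Cons:
  "cut_sum F (u @ x # t) =
     cut_sum (\<lambda>a b. F a (b @ x # t)) u + cut_sum (\<lambda>c d. F (u @ x # c) d) t"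
  by (induction u arbitrary: F) (simp_all add: add.assoc)

text \<open>Both sides run over the factorizations \<open>w = u @ v @ t\<close>, splitting off the
  first factor first on the left, the last factor first on the right.\<close>

lemma cut_sum_assoc:
  "cut_sum (\<lambda>u r. cut_sum (\<lambda>v t. F u v t) r) w = cut_sum (\<lambda>r t. cut_sum (\<lambda>u v. F u v t) r) w"
  by (induction w arbitrary: F) (simp_all add: add.assoc cut_sum_add)

lemma cut_sum_closed:
  assumes "\<And>u v. w = u @ v \<Longrightarrow> F u v \<in> N" "0 \<in> N" "\<And>x y. x \<in> N \<Longrightarrow> y \<in> N \<Longrightarrow> x + y \<in> N"
  shows "cut_sum F w \<in> N"
  using assms(1) by (induction w arbitrary: F) (auto intro!: assms(3))

text \<open>Additivity of \<open>\<phi>\<close> is asked for on \<open>N\<close> only, since a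
  cochain is additive in an entry only within one homogeneous component; the summands then have to
  be shown to lie in \<open>N\<close>.\<close>

lemma cut_sum_hom:
  assumes "\<And>u v. w = u @ v \<Longrightarrow> F u v \<in> N" "0 \<in> N" "\<And>x y. x \<in> N \<Longrightarrow> y \<in> N \<Longrightarrow> x + y \<in> N"
    and "\<phi> 0 = 0" "\<And>x y. x \<in> N \<Longrightarrow> y \<in> N \<Longrightarrow> \<phi> (x + y) = \<phi> x + \<phi> y"
  shows "\<phi> (cut_sum F w) = cut_sum (\<lambda>u v. \<phi> (F u v)) w"
  using assms(1)
proof (induction w arbitrary: F)
  case (Cons x w)
  have "F [] (x # w) \<in> N" "cut_sum (\<lambda>u. F (x # u)) w \<in> N"
    using assms(2,3) by (auto intro!: Cons.prems cut_sum_closed)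
  then show ?case
    using Cons.IH[of "\<lambda>u. F (x # u)"] Cons.prems by (simp add: assms(5))
qed (simp add: assms(4))

lemma cut_sum_eq_left:
  assumes "\<And>u v. w = u @ v \<Longrightarrow> v \<noteq> [] \<Longrightarrow> F u v = 0"
  shows "cut_sum F w = F w []"
  using assms by (induction w arbitrary: F) auto

lemma cut_sum_eq_right:
  assumes "\<And>u v. w = u @ v \<Longrightarrow> u \<noteq> [] \<Longrightarrow> F u v = 0"
  shows "cut_sum F w = F [] w"
proof (cases w)
  case (Cons x w')
  have "cut_sum (\<lambda>u. F (x # u)) w' = 0"
    using assms Cons by (intro cut_sum_eq_0) auto
  then show ?thesis by (simp add: Cons)
qed simp


section \<open>The Koszul sign\<close>

lemma koszul_sign_0 [simp]: "koszul_sign n 0 = 0"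
  by (simp add: koszul_sign_def)

lemma koszul_sign_add: "koszul_sign n (x + y) = koszul_sign n x + koszul_sign n y"
  by (simp add: koszul_sign_def)

lemma koszul_sign_koszul_sign: "koszul_sign m (koszul_sign n x) = koszul_sign (m + n) x"
  by (simp add: koszul_sign_def)

lemma koszul_sign_cong: "even (m - n) \<Longrightarrow> koszul_sign m x = koszul_sign n x"
  by (simp add: koszul_sign_def)

lemma koszul_sign_fun: "koszul_sign n f w = koszul_sign n (f w)"
  by (simp add: koszul_sign_def)

lemma koszul_sign_cut_sum:
  "koszul_sign n (cut_sum F w) = cut_sum (\<lambda>u v. koszul_sign n (F u v)) w"
  by (simp add: koszul_sign_def cut_sum_def sum_negf)


section \<open>Cochains as functions of words of arbitrary length\<close>

definition words :: "(int \<Rightarrow> 'a set) \<Rightarrow> 'a hword set" where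
  "words M = {w. \<forall>(d, x)\<in>set w. x \<in> M d}"

lemma words_simps [simp]:
  "[] \<in> words M" "y # w \<in> words M \<longleftrightarrow> snd y \<in> M (fst y) \<and> w \<in> words M"
  "u @ v \<in> words M \<longleftrightarrow> u \<in> words M \<and> v \<in> words M"
  by (auto simp: words_def)

lemma hwords_iff: "w \<in> hwords M n \<longleftrightarrow> length w = n \<and> w \<in> words M"
  by (auto simp: words_def hwords_def)

lemma wdeg_simps [simp]:
  "wdeg [] = 0" "wdeg (y # w) = fst y + wdeg w" "wdeg (u @ v) = wdeg u + wdeg v"
  by (simp_all add: wdeg_def)

text \<open>All arities are bundled in one \<open>F\<close>. The clause \<open>F [] = 0\<close>
  encodes that \<open>CC\<close> starts in arity 1; membership is stated for nonempty words because
  \<open>N\<close> is an arbitrary family here and may lack 0.\<close>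

definition multilinear ::
  "('k::comm_ring_1 \<Rightarrow> 'a::ab_group_add \<Rightarrow> 'a) \<Rightarrow> ('k \<Rightarrow> 'b::ab_group_add \<Rightarrow> 'b) \<Rightarrow>
   (int \<Rightarrow> 'a set) \<Rightarrow> (int \<Rightarrow> 'b set) \<Rightarrow> int \<Rightarrow> ('a hword \<Rightarrow> 'b) \<Rightarrow> bool" where
  "multilinear s t M N p F \<longleftrightarrow>
     F [] = 0 \<and> (\<forall>w. w \<notin> words M \<longrightarrow> F w = 0) \<and>
     (\<forall>w\<in>words M. w \<noteq> [] \<longrightarrow> F w \<in> N (wdeg w + p)) \<and>
     (\<forall>u\<in>words M. \<forall>v\<in>words M. \<forall>d. \<forall>x\<in>M d. \<forall>y\<in>M d.
        F (u @ (d, x + y) # v) = F (u @ (d, x) # v) + F (u @ (d, y) # v)) \<and>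
     (\<forall>u\<in>words M. \<forall>v\<in>words M. \<forall>d. \<forall>x\<in>M d. \<forall>c.
        F (u @ (d, s c x) # v) = t c (F (u @ (d, x) # v)))"

lemma multilinearI:
  assumes "F [] = 0" "\<And>w. w \<notin> words M \<Longrightarrow> F w = 0"
    "\<And>w. w \<in> words M \<Longrightarrow> w \<noteq> [] \<Longrightarrow> F w \<in> N (wdeg w + p)"
    "\<And>u v d x y. u \<in> words M \<Longrightarrow> v \<in> words M \<Longrightarrow> x \<in> M d \<Longrightarrow> y \<in> M d \<Longrightarrow>
        F (u @ (d, x + y) # v) = F (u @ (d, x) # v) + F (u @ (d, y) # v)"
    "\<And>u v d x c. u \<in> words M \<Longrightarrow> v \<in> words M \<Longrightarrow> x \<in> M d \<Longrightarrow>
        F (u @ (d, s c x) # v) = t c (F (u @ (d, x) # v))"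
  shows "multilinear s t M N p F"
  using assms unfolding multilinear_def by blast

text \<open>The arity index of a cochain is redundant: the value is 0 unless the index is the length
  of the word (\<open>graded_length\<close>). \<open>flat\<close> drops it, and
  \<open>CC_iff\<close> shows that nothing is lost.\<close>

definition flat :: "('a, 'b) cochain \<Rightarrow> 'a hword \<Rightarrow> 'b" where
  "flat f w = f (length w) w"

definition graded_length :: "('a, 'b::zero) cochain \<Rightarrow> bool" where
  "graded_length f \<longleftrightarrow> (\<forall>n w. length w \<noteq> n \<longrightarrow> f n w = 0)"

lemma flat_eqI: "graded_length f \<Longrightarrow> graded_length g \<Longrightarrow> flat f = flat g \<Longrightarrow> f = g"
  unfolding graded_length_def flat_def fun_eq_iff by metis

lemma CC_iff:
  "f \<in> CC s t A B p \<longleftrightarrow>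
     graded_length f \<and> multilinear s t (suspension A) (suspension B) p (flat f)"
    (is "_ \<longleftrightarrow> ?R")
proof
  assume f: "f \<in> CC s t A B p"
  have *: "f n \<in> tensor_hom s t (suspension A) (suspension B) n p" if "n \<noteq> 0" for n
    using f that by (simp add: CC_def)
  have f0: "f 0 = 0" using f by (simp add: CC_def)
  have "graded_length f"
    unfolding graded_length_def
  proof (intro allI impI)
    fix n and w :: "'a hword" assume "length w \<noteq> n"
    then show "f n w = 0"
      using *[of n] f0 by (cases "n = 0") (auto simp: tensor_hom_def hwords_iff)
  qed
  moreover have "multilinear s t (suspension A) (suspension B) p (flat f)"
  proof (rule multilinearI)
    show "flat f [] = 0" using f0 by (simp add: flat_def)
  next
    fix w :: "'a hword" assume "w \<notin> words (suspension A)"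
    then show "flat f w = 0" using *[of "length w"] 
      by (cases "w = []") (auto simp: tensor_hom_def hwords_iff flat_def)
  next
    fix w assume "w \<in> words (suspension A)" "w \<noteq> []"
    then show "flat f w \<in> suspension B (wdeg w + p)" using *[of "length w"]
      by (auto simp: tensor_hom_def hwords_iff flat_def)
  next
    fix u v d x y
    assume "u \<in> words (suspension A)" "v \<in> words (suspension A)"
      "x \<in> suspension A d" "y \<in> suspension A d"
    then show "flat f (u @ (d, x + y) # v) = flat f (u @ (d, x) # v) + flat f (u @ (d, y) # v)"
      using *[of "Suc (length u + length v)"]
      by (simp add: tensor_hom_def hwords_iff flat_def)
  next
    fix u v d x c
    assume "u \<in> words (suspension A)" "v \<in> words (suspension A)" "x \<in> suspension A d"
    then show "flat f (u @ (d, s c x) # v) = t c (flat f (u @ (d, x) # v))"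
      using *[of "Suc (length u + length v)"]
      by (simp add: tensor_hom_def hwords_iff flat_def)
  qed
  ultimately show ?R by blast
next
  assume R: ?R
  then have len: "f n w = 0" if "length w \<noteq> n" for n w
    using that by (simp add: graded_length_def)
  have f: "f (length w) w = flat f w" for w by (simp add: flat_def)
  from R have ml: "multilinear s t (suspension A) (suspension B) p (flat f)" by blast
  have "f 0 w = 0" for w
    using len[of w 0] ml f[of "[]"] by (cases w) (simp_all add: multilinear_def)
  then have f0: "f 0 = 0" by (simp add: fun_eq_iff)
  show "f \<in> CC s t A B p"
    unfolding CC_def mem_Collect_eq tensor_hom_def
  proof (intro conjI allI impI ballI f0)
    fix n w assume "w \<notin> hwords (suspension A) n"
    then show "f n w = 0" using len[of w n] f[of w] ml
      by (cases "length w = n") (auto simp: hwords_iff multilinear_def)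
  next
    fix n w assume "(1::nat) \<le> n" "w \<in> hwords (suspension A) n"
    then show "f n w \<in> suspension B (wdeg w + p)" using ml f[of w]
      by (auto simp: hwords_iff multilinear_def)
  next
    fix n u v d x y
    assume "u @ (d, x) # v \<in> hwords (suspension A) n" "u @ (d, y) # v \<in> hwords (suspension A) n"
    then show "f n (u @ (d, x + y) # v) = f n (u @ (d, x) # v) + f n (u @ (d, y) # v)"
      using ml f[of "u @ (d, x) # v"] f[of "u @ (d, y) # v"] f[of "u @ (d, x + y) # v"]
      by (auto simp: hwords_iff multilinear_def)
  next
    fix n u v d x c
    assume "u @ (d, x) # v \<in> hwords (suspension A) n"
    then show "f n (u @ (d, s c x) # v) = t c (f n (u @ (d, x) # v))"
      using ml f[of "u @ (d, x) # v"] f[of "u @ (d, s c x) # v"]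
      by (auto simp: hwords_iff multilinear_def)
  qed
qed

lemma multilinear_mem:
  "multilinear s t M N p F \<Longrightarrow> w \<in> words M \<Longrightarrow> w \<noteq> [] \<Longrightarrow> F w \<in> N (wdeg w + p)"
  and multilinear_Nil: "multilinear s t M N p F \<Longrightarrow> F [] = 0"
  and multilinear_outside: "multilinear s t M N p F \<Longrightarrow> w \<notin> words M \<Longrightarrow> F w = 0"
  and multilinear_add: "multilinear s t M N p F \<Longrightarrow> u \<in> words M \<Longrightarrow> v \<in> words M \<Longrightarrow>
     x \<in> M d \<Longrightarrow> y \<in> M d \<Longrightarrow> F (u @ (d, x + y) # v) = F (u @ (d, x) # v) + F (u @ (d, y) # v)"
  and multilinear_scale: "multilinear s t M N p F \<Longrightarrow> u \<in> words M \<Longrightarrow> v \<in> words M \<Longrightarrow>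
     x \<in> M d \<Longrightarrow> F (u @ (d, s c x) # v) = t c (F (u @ (d, x) # v))"
  unfolding multilinear_def by blast+

lemma graded_module_mem:
  assumes "graded_module s M"
  shows "0 \<in> M i" "x \<in> M i \<Longrightarrow> y \<in> M i \<Longrightarrow> x + y \<in> M i" "x \<in> M i \<Longrightarrow> s c x \<in> M i"
    "x \<in> M i \<Longrightarrow> - x \<in> M i" "x \<in> M i \<Longrightarrow> y \<in> M i \<Longrightarrow> x - y \<in> M i"
    "x \<in> M i \<Longrightarrow> koszul_sign n x \<in> M i"
proof -
  interpret module s using assms by (simp add: graded_module_def)
  have *: "subspace (M i)" using assms by (simp add: graded_module_def)
  show "0 \<in> M i" "x \<in> M i \<Longrightarrow> y \<in> M i \<Longrightarrow> x + y \<in> M i" "x \<in> M i \<Longrightarrow> s c x \<in> M i"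
    "x \<in> M i \<Longrightarrow> - x \<in> M i" "x \<in> M i \<Longrightarrow> y \<in> M i \<Longrightarrow> x - y \<in> M i"
    "x \<in> M i \<Longrightarrow> koszul_sign n x \<in> M i"
    using * by (auto simp: subspace_0 subspace_add subspace_scale subspace_neg subspace_diff
      koszul_sign_def)
qed

lemma multilinear_mem':
  assumes "graded_module s N" "multilinear s' t M N p F" "w \<in> words M"
  shows "F w \<in> N (wdeg w + p)"
  using assms multilinear_mem[OF assms(2,3)] multilinear_Nil[OF assms(2)]
    graded_module_mem(1)[OF assms(1)] by (cases "w = []") auto

text \<open>On genuine words this is additivity at \<open>0 + 0\<close>, elsewhere \<open>F\<close>
  vanishes anyway. It removes every term whose inner cochain is 0.\<close>

lemma multilinear_zero:
  assumes "graded_module s M" "graded_module t N" "multilinear s t M N p F"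
  shows "F (u @ (d, 0) # v) = 0"
proof (cases "u \<in> words M \<and> v \<in> words M")
  case True
  then show ?thesis
    using multilinear_add[OF assms(3), of u v 0 d 0] graded_module_mem(1)[OF assms(1)] by simp
qed (use multilinear_outside[OF assms(3)] in auto)

lemma multilinear_koszul_sign:
  assumes "graded_module s M" "graded_module t N" "multilinear s t M N p F"
    "u \<in> words M" "v \<in> words M" "x \<in> M d"
  shows "F (u @ (d, koszul_sign n x) # v) = koszul_sign n (F (u @ (d, x) # v))"
proof -
  have "F (u @ (d, x + - x) # v) = F (u @ (d, x) # v) + F (u @ (d, - x) # v)"
    using assms graded_module_mem(4)[OF assms(1)] by (intro multilinear_add) auto
  then have "F (u @ (d, - x) # v) = - F (u @ (d, x) # v)"
    using multilinear_zero[OF assms(1-3), of u d v] by (simp add: eq_neg_iff_add_eq_0 add.commute)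
  then show ?thesis by (simp add: koszul_sign_def)
qed

lemma graded_module_suspension: "graded_module s M \<Longrightarrow> graded_module s (suspension M)"
  by (simp add: graded_module_def suspension_def)


section \<open>The Gerstenhaber product\<close>

definition circ ::
  "int \<Rightarrow> ('a hword \<Rightarrow> 'b::ab_group_add) \<Rightarrow> ('a hword \<Rightarrow> 'a) \<Rightarrow> 'a hword \<Rightarrow> 'b" where
  "circ p G F w =
     cut_sum (\<lambda>u r. cut_sum (\<lambda>v t.
       koszul_sign (p * wdeg u) (G (u @ (wdeg v + p, F v) # t))) r) w"

text \<open>The index pair (i, j) of \<open>gerst\<close> is the block that starts after
  \<open>j\<close> entries and has length \<open>n - i + 1\<close>; \<open>circ\<close> sums over
  these blocks and the empty ones.\<close>

lemma gerst_eq_circ: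
  assumes M: "graded_module s (suspension A)" and N: "graded_module t (suspension B)"
    and g: "g \<in> CC s t A B q" and f: "f \<in> CC s s A A p"
  shows "gerst p g f (length w) w = circ p (flat g) (flat f) w"
proof -
  let ?n = "length w"
  define h where "h = (\<lambda>j m. koszul_sign (p * wdeg (take j w))
    (flat g (take j w @ (wdeg (take m (drop j w)) + p, flat f (take m (drop j w))) # drop m (drop j w))))"
  have h0: "h j 0 = 0" for j
    using f g multilinear_zero[OF M N, of q "flat g"] multilinear_Nil[of s s "suspension A" "suspension A" p "flat f"]
    by (simp add: h_def CC_iff)
  have "circ p (flat g) (flat f) w = (\<Sum>j\<le>?n. \<Sum>m\<le>?n - j. h j m)"
    by (simp add: circ_def cut_sum_def h_def)
  also have "\<dots> = (\<Sum>(j, m)\<in>Sigma {..?n} (\<lambda>j. {..?n - j}). h j m)"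
    by (subst sum.Sigma) auto
  \<comment> \<open>Empty blocks contribute 0: \<open>flat f []\<close> is 0, and
    \<open>flat g\<close> vanishes on a word with a zero entry.\<close>
  also have "\<dots> = (\<Sum>(j, m)\<in>Sigma {..?n} (\<lambda>j. {1..?n - j}). h j m)"
    by (rule sum.mono_neutral_right) (auto simp: Suc_le_eq h0 intro!: gr0I)
  also have "\<dots> = (\<Sum>(i, j)\<in>Sigma {1..?n} (\<lambda>i. {0..i - 1}). h j (?n - i + 1))"
    by (rule sum.reindex_bij_witness[where
        i = "\<lambda>(i, j). (j, ?n - i + 1)" and j = "\<lambda>(j, m). (?n - m + 1, j)"]) auto
  also have "\<dots> = (\<Sum>i = 1..?n. \<Sum>j = 0..i - 1. h j (?n - i + 1))"
    by (subst sum.Sigma) auto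
  also have "\<dots> = gerst p g f ?n w"
    unfolding gerst_def
  proof (intro sum.cong refl arg_cong[where f = "koszul_sign _"])
    fix i j assume "i \<in> {1..?n}" "j \<in> {0..i - 1}"
    then have "length (take (?n - i + 1) (drop j w)) = ?n - i + 1"
      "length (take j w @ y # drop (?n - i + 1) (drop j w)) = i" for y
      by auto
    then show "h j (?n - i + 1) =
        koszul_sign (p * wdeg (take j w)) (g i (insert_map p f (?n - i + 1) j w))"
      by (simp only: h_def insert_map_def Let_def flat_def drop_drop add.commute)
  qed
  finally show ?thesis by simp
qed

lemma graded_length_gerst:
  fixes f :: "('a::ab_group_add, 'a) cochain"
  assumes M: "graded_module s (suspension A)" and N: "graded_module t (suspension B)"
    and g: "g \<in> CC s t A B q" and f: "f \<in> CC s s A A p"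
  shows "graded_length (gerst p g f)"
  unfolding graded_length_def gerst_def
proof (intro allI impI sum.neutral ballI)
  fix n i j and w :: "'a hword"
  assume n: "length w \<noteq> n" and i: "i \<in> {1..n}" and j: "j \<in> {0..i - 1}"
  have gl: "graded_length f" "graded_length g"
    and ml: "multilinear s t (suspension A) (suspension B) q (flat g)"
    using f g by (simp_all add: CC_iff)
  let ?w = "insert_map p f (n - i + 1) j w"
  have "g i ?w = 0"
  proof (cases "length ?w = i")
    case True
    \<comment> \<open>\<open>take\<close> and \<open>drop\<close> truncate silently. If the whole
      block fitted into \<open>w\<close>, the outer word could have length \<open>i\<close> only for
      \<open>length w = n\<close>. So the block is too short, and the inner cochain is 0 on
      it.\<close>
    have "length w < j + (n - i + 1)"
      using True n i j by (auto simp: insert_map_def Let_def min_def split: if_splits)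
    then have "f (n - i + 1) (take (n - i + 1) (drop j w)) = 0"
      using gl(1) unfolding graded_length_def by auto
    then have "?w = take j w @ (wdeg (take (n - i + 1) (drop j w)) + p, 0) # drop (j + (n - i + 1)) w"
      by (simp add: insert_map_def)
    then have "flat g ?w = 0"
      using multilinear_zero[OF M N ml] by metis
    then show ?thesis using True by (simp add: flat_def)
  qed (use gl(2) in \<open>simp add: graded_length_def\<close>)
  then show "koszul_sign (p * wdeg (take j w)) (g i ?w) = 0" by simp
qed

lemma flat_gerst:
  assumes "graded_module s (suspension A)" "graded_module t (suspension B)"
    and "g \<in> CC s t A B q" "f \<in> CC s s A A p"
  shows "flat (gerst p g f) = circ p (flat g) (flat f)"
  using gerst_eq_circ[OF assms] by (simp add: flat_def fun_eq_iff)

text \<open>The three sums are the positions of the block relative to \<open>x\<close>: left of it,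
  around it, right of it. In the last case the inserted map also moves past \<open>x\<close>, hence
  \<open>fst x\<close> in the sign.\<close>

lemma circ_append_Cons:
  "circ p G F (u @ x # t) =
     cut_sum (\<lambda>a b. cut_sum (\<lambda>c d.
       koszul_sign (p * wdeg a) (G (a @ (wdeg c + p, F c) # d @ x # t))) b) u +
     cut_sum (\<lambda>a b. cut_sum (\<lambda>c d.
       koszul_sign (p * wdeg a) (G (a @ (wdeg b + fst x + wdeg c + p, F (b @ x # c)) # d))) t) u +
     cut_sum (\<lambda>a b. cut_sum (\<lambda>c d.
       koszul_sign (p * (wdeg u + fst x + wdeg a)) (G (u @ x # a @ (wdeg c + p, F c) # d))) b) t"
  by (simp add: circ_def cut_sum_append_Cons cut_sum_add add.assoc)

context
  fixes s :: "'k::comm_ring_1 \<Rightarrow> 'a::ab_group_add \<Rightarrow> 'a" and M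
  assumes M: "graded_module s M"
begin

lemma multilinear_circ_mem:
  assumes G: "multilinear s s M M q G" and F: "multilinear s s M M p F"
    and w: "w \<in> words M"
  shows "circ p G F w \<in> M (wdeg w + (q + p))"
  unfolding circ_def
proof (intro cut_sum_closed graded_module_mem[OF M])
  fix u r v t assume "w = u @ r" "r = v @ t"
  then have *: "u \<in> words M" "v \<in> words M" "t \<in> words M" "wdeg w = wdeg u + wdeg v + wdeg t"
    using w by auto
  have "G (u @ (wdeg v + p, F v) # t) \<in> M (wdeg (u @ (wdeg v + p, F v) # t) + q)"
    using * multilinear_mem'[OF M F] by (intro multilinear_mem'[OF M G]) auto
  also have "wdeg (u @ (wdeg v + p, F v) # t) + q = wdeg w + (q + p)"
    using * by simp
  finally show "G (u @ (wdeg v + p, F v) # t) \<in> M (wdeg w + (q + p))" .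
qed

text \<open>An entry outside \<open>M\<close> either lies in the block, where \<open>F\<close>
  returns 0, or reaches \<open>G\<close>, which then returns 0.\<close>

lemma circ_outside:
  assumes G: "multilinear s s M M q G" and F: "multilinear s s M M p F"
    and w: "w \<notin> words M"
  shows "circ p G F w = 0"
  unfolding circ_def
proof (intro cut_sum_eq_0)
  fix u r v t assume "w = u @ r" "r = v @ t"
  with w have "u \<notin> words M \<or> v \<notin> words M \<or> t \<notin> words M" by auto
  then have "G (u @ (wdeg v + p, F v) # t) = 0"
    using multilinear_outside[OF G] multilinear_outside[OF F] multilinear_zero[OF M M G]
    by (cases "v \<in> words M") auto
  then show "koszul_sign (p * wdeg u) (G (u @ (wdeg v + p, F v) # t)) = 0" by simp
qed

lemma multilinear_circ:
  assumes G: "multilinear s s M M q G" and F: "multilinear s s M M p F"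
  shows "multilinear s s M M (q + p) (circ p G F)"
proof (rule multilinearI)
  show "circ p G F [] = 0"
    using multilinear_Nil[OF F] multilinear_zero[OF M M G, of "[]" p "[]"] 
    by (simp add: circ_def)
  show "circ p G F w = 0" if "w \<notin> words M" for w
    using circ_outside[OF G F that] .
  show "circ p G F w \<in> M (wdeg w + (q + p))" if "w \<in> words M" for w
    using multilinear_circ_mem[OF G F that] .
next
  fix u v d x y
  assume *: "u \<in> words M" "v \<in> words M" "x \<in> M d" "y \<in> M d"
  \<comment> \<open>\<open>T1\<close>, \<open>T2\<close>, \<open>T3\<close> are the terms in which
    the varied entry \<open>z\<close> lies right of, inside and left of the block. \<open>T2\<close>
    uses linearity of \<open>F\<close> and then of \<open>G\<close>, the other two only that of
    \<open>G\<close>.\<close>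
  define T1 where "T1 = (\<lambda>z a c e. koszul_sign (p * wdeg a) (G (a @ (wdeg c + p, F c) # e @ (d, z) # v)))"
  define T2 where "T2 = (\<lambda>z a b c e. koszul_sign (p * wdeg a)
    (G (a @ (wdeg b + d + wdeg c + p, F (b @ (d, z) # c)) # e)))"
  define T3 where "T3 = (\<lambda>z a c e. koszul_sign (p * (wdeg u + d + wdeg a))
    (G (u @ (d, z) # a @ (wdeg c + p, F c) # e)))"
  have expand: "circ p G F (u @ (d, z) # v) = cut_sum (\<lambda>a. cut_sum (T1 z a)) u +
      cut_sum (\<lambda>a b. cut_sum (T2 z a b) v) u + cut_sum (\<lambda>a. cut_sum (T3 z a)) v" for z
    by (simp add: circ_append_Cons T1_def T2_def T3_def)
  have "T1 (x + y) a c e = T1 x a c e + T1 y a c e" if "u = a @ b" "b = c @ e" for a b c e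
    using * that multilinear_add[OF G, of "a @ (wdeg c + p, F c) # e" v x d y]
      multilinear_mem'[OF M F, of c]
    by (simp add: T1_def koszul_sign_add)
  then have 1: "cut_sum (\<lambda>a. cut_sum (T1 (x + y) a)) u =
      cut_sum (\<lambda>a b. cut_sum (\<lambda>c e. T1 x a c e + T1 y a c e) b) u"
    by (intro cut_sum_cong)
  have "T2 (x + y) a b c e = T2 x a b c e + T2 y a b c e" if "u = a @ b" "v = c @ e" for a b c e
    using * that multilinear_add[OF F, of b c x d y]
      multilinear_add[OF G, of a e "F (b @ (d, x) # c)" "wdeg b + d + wdeg c + p" "F (b @ (d, y) # c)"]
      multilinear_mem'[OF M F, of "b @ (d, x) # c"] multilinear_mem'[OF M F, of "b @ (d, y) # c"]
    by (simp add: T2_def koszul_sign_add add.assoc)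
  then have 2: "cut_sum (\<lambda>a b. cut_sum (T2 (x + y) a b) v) u =
      cut_sum (\<lambda>a b. cut_sum (\<lambda>c e. T2 x a b c e + T2 y a b c e) v) u"
    by (intro cut_sum_cong)
  have "T3 (x + y) a c e = T3 x a c e + T3 y a c e" if "v = a @ b" "b = c @ e" for a b c e
    using * that multilinear_add[OF G, of u "a @ (wdeg c + p, F c) # e" x d y]
      multilinear_mem'[OF M F, of c]
    by (simp add: T3_def koszul_sign_add)
  then have 3: "cut_sum (\<lambda>a. cut_sum (T3 (x + y) a)) v =
      cut_sum (\<lambda>a b. cut_sum (\<lambda>c e. T3 x a c e + T3 y a c e) b) v"
    by (intro cut_sum_cong)
  show "circ p G F (u @ (d, x + y) # v) = circ p G F (u @ (d, x) # v) + circ p G F (u @ (d, y) # v)"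
    unfolding expand 1 2 3 cut_sum_add by (simp only: ac_simps)
next
  fix u v d x k
  assume *: "u \<in> words M" "v \<in> words M" "x \<in> M d"
  define T1 where "T1 = (\<lambda>z a c e. koszul_sign (p * wdeg a) (G (a @ (wdeg c + p, F c) # e @ (d, z) # v)))"
  define T2 where "T2 = (\<lambda>z a b c e. koszul_sign (p * wdeg a)
    (G (a @ (wdeg b + d + wdeg c + p, F (b @ (d, z) # c)) # e)))"
  define T3 where "T3 = (\<lambda>z a c e. koszul_sign (p * (wdeg u + d + wdeg a))
    (G (u @ (d, z) # a @ (wdeg c + p, F c) # e)))"
  have expand: "circ p G F (u @ (d, z) # v) = cut_sum (\<lambda>a. cut_sum (T1 z a)) u +
      cut_sum (\<lambda>a b. cut_sum (T2 z a b) v) u + cut_sum (\<lambda>a. cut_sum (T3 z a)) v" for z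
    by (simp add: circ_append_Cons T1_def T2_def T3_def)
  interpret module s using M by (simp add: graded_module_def)
  have sk: "koszul_sign n (s k z) = s k (koszul_sign n z)" for n z
    by (simp add: koszul_sign_def)
  have scut: "cut_sum (\<lambda>a b. s k (H a b)) w = s k (cut_sum H w)" for H and w :: "'a hword"
    by (simp add: cut_sum_def scale_sum_right)
  have "T1 (s k x) a c e = s k (T1 x a c e)" if "u = a @ b" "b = c @ e" for a b c e
    using * that multilinear_scale[OF G, of "a @ (wdeg c + p, F c) # e" v x d k]
      multilinear_mem'[OF M F, of c]
    by (simp add: T1_def sk)
  then have 1: "cut_sum (\<lambda>a. cut_sum (T1 (s k x) a)) u =
      cut_sum (\<lambda>a b. cut_sum (\<lambda>c e. s k (T1 x a c e)) b) u"
    by (intro cut_sum_cong)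
  have "T2 (s k x) a b c e = s k (T2 x a b c e)" if "u = a @ b" "v = c @ e" for a b c e
    using * that multilinear_scale[OF F, of b c x d k]
      multilinear_scale[OF G, of a e "F (b @ (d, x) # c)" "wdeg b + d + wdeg c + p" k]
      multilinear_mem'[OF M F, of "b @ (d, x) # c"]
    by (simp add: T2_def sk add.assoc)
  then have 2: "cut_sum (\<lambda>a b. cut_sum (T2 (s k x) a b) v) u =
      cut_sum (\<lambda>a b. cut_sum (\<lambda>c e. s k (T2 x a b c e)) v) u"
    by (intro cut_sum_cong)
  have "T3 (s k x) a c e = s k (T3 x a c e)" if "v = a @ b" "b = c @ e" for a b c e
    using * that multilinear_scale[OF G, of u "a @ (wdeg c + p, F c) # e" x d k]
      multilinear_mem'[OF M F, of c]
    by (simp add: T3_def sk)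
  then have 3: "cut_sum (\<lambda>a. cut_sum (T3 (s k x) a)) v =
      cut_sum (\<lambda>a b. cut_sum (\<lambda>c e. s k (T3 x a c e)) b) v"
    by (intro cut_sum_cong)
  show "circ p G F (u @ (d, s k x) # v) = s k (circ p G F (u @ (d, x) # v))"
    unfolding expand 1 2 3 scut by (simp only: scale_right_distrib)
qed

text \<open>
  The associator of \<open>circ\<close> consists of the terms in which \<open>G\<close> and \<open>H\<close> are inserted side by side
  into \<open>F\<close>; \<open>circ2\<close> collects those with \<open>H\<close> to the right of \<open>G\<close>.
\<close>

definition circ2 ::
  "int \<Rightarrow> int \<Rightarrow> ('a hword \<Rightarrow> 'a) \<Rightarrow> ('a hword \<Rightarrow> 'a) \<Rightarrow> ('a hword \<Rightarrow> 'a) \<Rightarrow> 'a hword \<Rightarrow> 'a" where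
  "circ2 q r F G H w =
     cut_sum (\<lambda>a. cut_sum (\<lambda>c. cut_sum (\<lambda>e. cut_sum (\<lambda>v t.
       koszul_sign (q * wdeg a + r * (wdeg a + wdeg c + wdeg e))
         (F (a @ (wdeg c + q, G c) # e @ (wdeg v + r, H v) # t)))))) w"

text \<open>\<open>circ_append_Cons\<close> is applied to the word in which a block has been
  replaced by its value under \<open>H\<close>, with that value as marked entry. The block of
  \<open>G\<close> lies left of it, around it or right of it, which gives the second, first and
  third summand on the right.\<close>

lemma circ_circ:
  assumes F: "multilinear s s M M p F" and G: "multilinear s s M M q G"
    and H: "multilinear s s M M r H" and w: "w \<in> words M"
  shows "circ r (circ q F G) H w =
    circ (q + r) F (circ r G H) w + circ2 q r F G H w + koszul_sign (q * r) (circ2 r q F H G w)"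
proof -
  define X1 where "X1 = (\<lambda>(u :: 'a hword) v t a c e. koszul_sign (r * wdeg u + q * wdeg a)
    (F (a @ (wdeg c + q, G c) # e @ (wdeg v + r, H v) # t)))"
  define X2 where "X2 = (\<lambda>a b v c e. koszul_sign (r * (wdeg a + wdeg b) + q * wdeg a)
    (F (a @ (wdeg b + (wdeg v + r) + wdeg c + q, G (b @ (wdeg v + r, H v) # c)) # e)))"
  define X3 where "X3 = (\<lambda>u v a c e. koszul_sign (r * wdeg u + q * (wdeg u + (wdeg v + r) + wdeg a))
    (F (u @ (wdeg v + r, H v) # a @ (wdeg c + q, G c) # e)))"
  have "circ r (circ q F G) H w =
    cut_sum (\<lambda>u. cut_sum (\<lambda>v t. cut_sum (\<lambda>a. cut_sum (X1 u v t a)) u)) w +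
    cut_sum (\<lambda>u. cut_sum (\<lambda>v t. cut_sum (\<lambda>a b. cut_sum (X2 a b v) t) u)) w +
    cut_sum (\<lambda>u. cut_sum (\<lambda>v t. cut_sum (\<lambda>a. cut_sum (X3 u v a)) t)) w"
    (is "_ = ?S1 + ?S2 + ?S3")
  proof -
    have "koszul_sign (r * wdeg u) (circ q F G (u @ (wdeg v + r, H v) # t)) =
      cut_sum (\<lambda>a. cut_sum (X1 u v t a)) u + cut_sum (\<lambda>a b. cut_sum (X2 a b v) t) u +
      cut_sum (\<lambda>a. cut_sum (X3 u v a)) t" for u v t
      unfolding circ_append_Cons koszul_sign_add koszul_sign_cut_sum koszul_sign_koszul_sign
        X1_def X2_def X3_def fst_conv
      by (intro arg_cong2[where f = "(+)"] cut_sum_cong) simp_all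
    then show ?thesis
      by (simp only: circ_def[of r] cut_sum_add)
  qed
  moreover have "?S1 = circ2 q r F G H w"
  proof -
    define Z where "Z = (\<lambda>a c e v t. koszul_sign (q * wdeg a + r * (wdeg a + wdeg c + wdeg e))
         (F (a @ (wdeg c + q, G c) # e @ (wdeg v + r, H v) # t)))"
    \<comment> \<open>Here the block of \<open>H\<close> was chosen first. Swaps of independent cuts
      and coassociativity bring the factors into the order a, c, e, v, t of
      \<open>circ2\<close>.\<close>
    have "?S1 = cut_sum (\<lambda>u. cut_sum (\<lambda>v t. cut_sum (\<lambda>a. cut_sum (\<lambda>c e. Z a c e v t)) u)) w"
      unfolding X1_def Z_def by (intro cut_sum_cong) (simp add: algebra_simps)
    also have "\<dots> = cut_sum (\<lambda>u x. cut_sum (\<lambda>a b. cut_sum (\<lambda>v t. cut_sum (\<lambda>c e. Z a c e v t) b) x) u) w"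
      by (intro cut_sum_cong cut_sum_swap)
    also have "\<dots> = cut_sum (\<lambda>a. cut_sum (\<lambda>b. cut_sum (\<lambda>v t. cut_sum (\<lambda>c e. Z a c e v t) b))) w"
      by (rule cut_sum_assoc[symmetric])
    also have "\<dots> = cut_sum (\<lambda>a. cut_sum (\<lambda>b x. cut_sum (\<lambda>c e. cut_sum (Z a c e) x) b)) w"
      by (intro cut_sum_cong cut_sum_swap)
    also have "\<dots> = cut_sum (\<lambda>a. cut_sum (\<lambda>c. cut_sum (\<lambda>e. cut_sum (Z a c e)))) w"
      by (intro cut_sum_cong cut_sum_assoc[symmetric])
    finally show ?thesis by (simp only: circ2_def Z_def)
  qed
  moreover have "?S2 = circ (q + r) F (circ r G H) w"
  proof -
    have "?S2 = cut_sum (\<lambda>u x. cut_sum (\<lambda>a b. cut_sum (\<lambda>v t. cut_sum (X2 a b v) t) x) u) w"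
      by (intro cut_sum_cong cut_sum_swap)
    also have "\<dots> = cut_sum (\<lambda>a. cut_sum (\<lambda>b. cut_sum (\<lambda>v. cut_sum (X2 a b v)))) w"
      by (rule cut_sum_assoc[symmetric])
    also have "\<dots> = cut_sum (\<lambda>a. cut_sum (\<lambda>b x. cut_sum (\<lambda>z d. cut_sum (\<lambda>v c. X2 a b v c d) z) x)) w"
      by (intro cut_sum_cong cut_sum_assoc)
    also have "\<dots> = cut_sum (\<lambda>a. cut_sum (\<lambda>y d. cut_sum (\<lambda>b. cut_sum (\<lambda>v c. X2 a b v c d)) y)) w"
      by (intro cut_sum_cong cut_sum_assoc)
    also have "\<dots> = circ (q + r) F (circ r G H) w"
      unfolding circ_def[of "q + r"]
    proof (intro cut_sum_cong)
      fix a x y d assume "w = a @ x" "x = y @ d"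
      with w have ad: "a \<in> words M" "y \<in> words M" "d \<in> words M" by auto
      define D where "D = wdeg y + (q + r)"
      \<comment> \<open>One slot of \<open>F\<close>, with the sign in front, as a function that is
        additive on the component of degree \<open>D\<close>. Moving it inside the cuts of
        \<open>y\<close> turns the value of \<open>F\<close> at \<open>circ r G H y\<close> into the
        sum of the terms \<open>X2\<close>.\<close>
      define \<phi> where "\<phi> = (\<lambda>z. koszul_sign ((q + r) * wdeg a) (F (a @ (D, z) # d)))"
      have \<phi>: "\<phi> 0 = 0" "\<And>z z'. z \<in> M D \<Longrightarrow> z' \<in> M D \<Longrightarrow> \<phi> (z + z') = \<phi> z + \<phi> z'"
        using ad by (simp_all add: \<phi>_def multilinear_zero[OF M M F] multilinear_add[OF F] koszul_sign_add)
      define Y where "Y = (\<lambda>b v c. koszul_sign (r * wdeg b) (G (b @ (wdeg v + r, H v) # c)))"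
      have G_mem: "G (b @ (wdeg v + r, H v) # c) \<in> M D" if "y = b @ z" "z = v @ c" for b z v c
        using multilinear_mem'[OF M G, of "b @ (wdeg v + r, H v) # c"] multilinear_mem'[OF M H, of v]
          ad that by (simp add: D_def algebra_simps)
      then have mem: "Y b v c \<in> M D" if "y = b @ z" "z = v @ c" for b z v c
        using that graded_module_mem[OF M] by (simp add: Y_def)
      have "\<phi> (circ r G H y) = \<phi> (cut_sum (\<lambda>b. cut_sum (Y b)) y)"
        by (simp add: circ_def Y_def)
      also have "\<dots> = cut_sum (\<lambda>b z. \<phi> (cut_sum (Y b) z)) y"
        using mem by (intro cut_sum_hom[where N = "M D"] \<phi> cut_sum_closed graded_module_mem[OF M])
      also have "\<dots> = cut_sum (\<lambda>b. cut_sum (\<lambda>v c. \<phi> (Y b v c))) y"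
        using mem by (intro cut_sum_cong cut_sum_hom[where N = "M D"] \<phi> graded_module_mem[OF M])
      also have "\<dots> = cut_sum (\<lambda>b. cut_sum (\<lambda>v c. X2 a b v c d)) y"
      proof (intro cut_sum_cong)
        fix b z v c assume *: "y = b @ z" "z = v @ c"
        show "\<phi> (Y b v c) = X2 a b v c d"
          using multilinear_koszul_sign[OF M M F ad(1,3) G_mem[OF *], of "r * wdeg b"] *
          by (simp add: \<phi>_def Y_def X2_def D_def koszul_sign_koszul_sign algebra_simps)
      qed
      finally show "cut_sum (\<lambda>b. cut_sum (\<lambda>v c. X2 a b v c d)) y =
          koszul_sign ((q + r) * wdeg a) (F (a @ (wdeg y + (q + r), circ r G H y) # d))"
        by (simp add: \<phi>_def D_def)
    qed
    finally show ?thesis .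
  qed
  \<comment> \<open>These cuts are already in the order of \<open>circ2\<close>; the extra sign
    \<open>q * r\<close> comes from \<open>G\<close> moving past \<open>H\<close>.\<close>
  moreover have "?S3 = koszul_sign (q * r) (circ2 r q F H G w)"
    unfolding circ2_def koszul_sign_cut_sum koszul_sign_koszul_sign X3_def
    by (intro cut_sum_cong koszul_sign_cong) (simp add: algebra_simps)
  ultimately show ?thesis by (simp only: ac_simps)
qed

lemma circ_pre_lie:
  assumes F: "multilinear s s M M p F" and G: "multilinear s s M M q G"
    and H: "multilinear s s M M r H" and w: "w \<in> words M"
  shows "circ r (circ q F G) H w - circ (q + r) F (circ r G H) w =
    koszul_sign (q * r) (circ q (circ r F H) G w - circ (q + r) F (circ q H G) w)"
  using circ_circ[OF F G H w] circ_circ[OF F H G w]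
  by (simp add: koszul_sign_def algebra_simps)

end

section \<open>The graded Lie algebra of cochains\<close>

lemma graded_lie_subalgebra_imp_lie_algebra:
  assumes "graded_lie_subalgebra s K L br"
  shows "graded_lie_algebra s K br"
proof -
  have L: "graded_lie_algebra s L br" and K: "graded_module s K" and sub: "\<And>p. K p \<subseteq> L p"
    and br: "\<And>p q x y. x \<in> K p \<Longrightarrow> y \<in> K q \<Longrightarrow> br p q x y \<in> K (p + q)"
    using assms by (auto simp: graded_lie_subalgebra_def graded_submodule_def)
  show ?thesis
    unfolding graded_lie_algebra_def
    by (intro conjI K; (intro allI ballI impI)?)
      (rule br, assumption, assumption,
        (insert L[unfolded graded_lie_algebra_def] sub; meson subsetD)+)
qed

lemma (in module) scale_half_double: "2 * h = 1 \<Longrightarrow> scale h (x + x) = x"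
  by (simp only: scale_right_distrib scale_left_distrib[symmetric] mult_2[symmetric] scale_one)

lemma graded_length_simps:
  "graded_length f \<Longrightarrow> graded_length g \<Longrightarrow> graded_length (f + g)"
  "graded_length f \<Longrightarrow> graded_length g \<Longrightarrow> graded_length (f - g :: ('a, 'b::ab_group_add) cochain)"
  by (simp_all add: graded_length_def)

lemma flat_simps:
  "flat (f + g) w = flat f w + flat g w" "flat (cc_scale t c f) w = t c (flat f w)" "flat 0 w = 0"
  by (simp_all add: flat_def cc_scale_def)

lemma module_cc_scale:
  assumes "module t"
  shows "module (cc_scale t :: _ \<Rightarrow> ('a, 'b::ab_group_add) cochain \<Rightarrow> _)"
proof -
  interpret module t by fact
  show ?thesis
    by standard (simp_all add: cc_scale_def fun_eq_iff scale_right_distrib scale_left_distrib)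
qed

lemma graded_module_CC:
  assumes "module s" and B: "graded_module t B"
  shows "graded_module (cc_scale t) (CC s t A B)"
proof -
  interpret s: module s by fact
  interpret t: module t using B by (simp add: graded_module_def)
  interpret module "cc_scale t :: _ \<Rightarrow> ('b, 'c) cochain \<Rightarrow> _"
    by (intro module_cc_scale t.module_axioms)
  note B = graded_module_mem[OF graded_module_suspension[OF B]]
  show ?thesis
    unfolding graded_module_def
  proof (intro conjI allI module_axioms subspaceI)
    show "0 \<in> CC s t A B i" for i
      unfolding CC_iff using B
      by (intro conjI multilinearI) (simp_all add: flat_simps graded_length_def)
  next
    fix i f g assume fg: "f \<in> CC s t A B i" "g \<in> CC s t A B i"
    then have f: "multilinear s t (suspension A) (suspension B) i (flat f)"
      and g: "multilinear s t (suspension A) (suspension B) i (flat g)"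
      and len: "graded_length (f + g)"
      by (simp_all add: CC_iff graded_length_simps)
    show "f + g \<in> CC s t A B i"
      unfolding CC_iff using multilinear_mem[OF f] multilinear_mem[OF g] B
      by (intro conjI multilinearI len)
        (simp_all add: flat_simps multilinear_Nil[OF f] multilinear_Nil[OF g]
          multilinear_outside[OF f] multilinear_outside[OF g] multilinear_add[OF f]
          multilinear_add[OF g] multilinear_scale[OF f] multilinear_scale[OF g]
          t.scale_right_distrib)
  next
    fix i f c assume f: "f \<in> CC s t A B i"
    then have f: "multilinear s t (suspension A) (suspension B) i (flat f)"
      and len: "graded_length (cc_scale t c f)"
      by (simp_all add: CC_iff graded_length_def cc_scale_def)
    show "cc_scale t c f \<in> CC s t A B i"
      unfolding CC_iff using multilinear_mem[OF f] B
      by (intro conjI multilinearI len)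
        (simp_all add: flat_simps multilinear_Nil[OF f] multilinear_outside[OF f]
          multilinear_add[OF f] multilinear_scale[OF f] t.scale_right_distrib mult.commute)
  qed
qed

text \<open>Linearity in the outer cochain is pointwise. In the inner one
  (\<open>gerst_add_right\<close>, \<open>gerst_scale_right\<close>) the values are fed into the
  outer cochain, so its multilinearity is used and words outside the module are treated
  separately.\<close>

lemma gerst_add_left: "gerst p (g + g') f = gerst p g f + gerst p g' f"
  by (simp add: fun_eq_iff gerst_def koszul_sign_add sum.distrib)

lemma gerst_diff_left: "gerst p (g - g') f = gerst p g f - gerst p g' f"
  by (metis add_diff_cancel_right' diff_add_cancel gerst_add_left)

lemma gerst_koszul_sign_left: "gerst p (koszul_sign n g) f = koszul_sign n (gerst p g f)"
  using gerst_diff_left[of p 0 g f] gerst_diff_left[of p g g f] by (simp add: koszul_sign_def)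

lemma gerst_scale_left:
  assumes "module t"
  shows "gerst p (cc_scale t c g) f = cc_scale t c (gerst p g f)"
proof -
  interpret module t by fact
  show ?thesis
    by (simp add: fun_eq_iff gerst_def cc_scale_def koszul_sign_def scale_sum_right if_distrib
        cong: if_cong)
qed

context
  fixes s :: "'k::comm_ring_1 \<Rightarrow> 'a::ab_group_add \<Rightarrow> 'a" and A
  assumes A: "graded_module s A"
begin

private lemma susp: "graded_module s (suspension A)"
  using A by (rule graded_module_suspension)

private lemma s: "module s"
  using A by (simp add: graded_module_def)

lemmas CC_mem = graded_module_mem[OF graded_module_CC[OF s A]]

lemma gerst_mem:
  assumes g: "g \<in> CC s s A A q" and f: "f \<in> CC s s A A p"
  shows "gerst p g f \<in> CC s s A A (q + p)"
  using multilinear_circ[OF susp, of q "flat g" p "flat f"] f g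
  by (simp add: CC_iff[of "gerst p g f"] graded_length_gerst[OF susp susp g f] flat_gerst[OF susp susp g f])
    (simp add: CC_iff)

lemma gerst_add_right:
  assumes g: "g \<in> CC s s A A q" and f: "f \<in> CC s s A A p" "f' \<in> CC s s A A p"
  shows "gerst p g (f + f') = gerst p g f + gerst p g f'"
proof (rule flat_eqI)
  note * = CC_mem(2)[OF f]
  show "graded_length (gerst p g (f + f'))" "graded_length (gerst p g f + gerst p g f')"
    by (intro graded_length_simps graded_length_gerst[OF susp susp g] f *)+
  have G: "multilinear s s (suspension A) (suspension A) q (flat g)"
    and F: "multilinear s s (suspension A) (suspension A) p (flat f)"
      "multilinear s s (suspension A) (suspension A) p (flat f')"
      "multilinear s s (suspension A) (suspension A) p (flat (f + f'))"
    using f g * by (simp_all add: CC_iff)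
  show "flat (gerst p g (f + f')) = flat (gerst p g f + gerst p g f')"
  proof
    fix w
    show "flat (gerst p g (f + f')) w = flat (gerst p g f + gerst p g f') w"
    proof (cases "w \<in> words (suspension A)")
      case True
      have "circ p (flat g) (flat (f + f')) w = circ p (flat g) (flat f) w + circ p (flat g) (flat f') w"
        unfolding circ_def cut_sum_add[symmetric]
      proof (intro cut_sum_cong)
        fix u x v t assume "w = u @ x" "x = v @ t"
        with True have "u \<in> words (suspension A)" "v \<in> words (suspension A)" "t \<in> words (suspension A)"
          by auto
        then show "koszul_sign (p * wdeg u) (flat g (u @ (wdeg v + p, flat (f + f') v) # t)) =
          koszul_sign (p * wdeg u) (flat g (u @ (wdeg v + p, flat f v) # t)) +
          koszul_sign (p * wdeg u) (flat g (u @ (wdeg v + p, flat f' v) # t))"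
          using multilinear_mem'[OF susp F(1)] multilinear_mem'[OF susp F(2)]
          by (simp add: flat_simps multilinear_add[OF G] koszul_sign_add)
      qed
      then show ?thesis
        by (simp add: flat_gerst[OF susp susp g] f * flat_simps)
    qed (simp add: flat_gerst[OF susp susp g] f * flat_simps circ_outside[OF susp G] F)
  qed
qed

lemma gerst_scale_right:
  assumes g: "g \<in> CC s s A A q" and f: "f \<in> CC s s A A p"
  shows "gerst p g (cc_scale s c f) = cc_scale s c (gerst p g f)"
proof (rule flat_eqI)
  interpret module s by (rule s)
  note * = CC_mem(3)[OF f, of c]
  show "graded_length (gerst p g (cc_scale s c f))"
    by (intro graded_length_gerst[OF susp susp g] *)
  show "graded_length (cc_scale s c (gerst p g f))"
    using graded_length_gerst[OF susp susp g f] by (simp add: graded_length_def cc_scale_def)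
  have G: "multilinear s s (suspension A) (suspension A) q (flat g)"
    and F: "multilinear s s (suspension A) (suspension A) p (flat f)"
      "multilinear s s (suspension A) (suspension A) p (flat (cc_scale s c f))"
    using f g * by (simp_all add: CC_iff)
  show "flat (gerst p g (cc_scale s c f)) = flat (cc_scale s c (gerst p g f))"
  proof
    fix w
    show "flat (gerst p g (cc_scale s c f)) w = flat (cc_scale s c (gerst p g f)) w"
    proof (cases "w \<in> words (suspension A)")
      case True
      have scut: "s c (cut_sum H w) = cut_sum (\<lambda>a b. s c (H a b)) w" for H and w :: "'a hword"
        by (simp add: cut_sum_def scale_sum_right)
      have "circ p (flat g) (flat (cc_scale s c f)) w = s c (circ p (flat g) (flat f) w)"
        unfolding circ_def scut
      proof (intro cut_sum_cong)
        fix u x v t assume "w = u @ x" "x = v @ t"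
        with True have "u \<in> words (suspension A)" "v \<in> words (suspension A)" "t \<in> words (suspension A)"
          by auto
        then show "koszul_sign (p * wdeg u) (flat g (u @ (wdeg v + p, flat (cc_scale s c f) v) # t)) =
          s c (koszul_sign (p * wdeg u) (flat g (u @ (wdeg v + p, flat f v) # t)))"
          using multilinear_mem'[OF susp F(1)]
          by (simp add: flat_simps multilinear_scale[OF G] koszul_sign_def)
      qed
      then show ?thesis
        by (simp add: flat_gerst[OF susp susp g] f * flat_simps)
    qed (simp add: flat_gerst[OF susp susp g] f * flat_simps circ_outside[OF susp G] F)
  qed
qed

lemma gerst_diff_right:
  assumes "g \<in> CC s s A A q" "f \<in> CC s s A A p" "f' \<in> CC s s A A p"
  shows "gerst p g (f - f') = gerst p g f - gerst p g f'"
  using gerst_add_right[OF assms(1) CC_mem(5)[OF assms(2,3)] assms(3)] by (simp add: algebra_simps)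

lemma gerst_koszul_sign_right:
  assumes "g \<in> CC s s A A q" "f \<in> CC s s A A p"
  shows "gerst p g (koszul_sign n f) = koszul_sign n (gerst p g f)"
  using gerst_diff_right[OF assms(1) assms(2,2)] gerst_diff_right[OF assms(1) CC_mem(1) assms(2)]
  by (simp add: koszul_sign_def)

lemma gerst_pre_lie:
  assumes f: "f \<in> CC s s A A p" and g: "g \<in> CC s s A A q" and h: "h \<in> CC s s A A r"
  shows "gerst r (gerst q f g) h - gerst (q + r) f (gerst r g h) =
    koszul_sign (q * r) (gerst q (gerst r f h) g - gerst (q + r) f (gerst q h g))"
proof (rule flat_eqI)
  \<comment> \<open>Degrees are explicit arguments of \<open>gerst\<close>, hence the rewriting of
    \<open>r + q\<close> to \<open>q + r\<close>.\<close>
  note m = gerst_mem[OF f g] gerst_mem[OF f h] gerst_mem[OF g h]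
    gerst_mem[OF h g, unfolded add.commute[of r q]]
  note len = graded_length_gerst[OF susp susp]
  show "graded_length (gerst r (gerst q f g) h - gerst (q + r) f (gerst r g h))"
    by (intro graded_length_simps len[OF m(1) h] len[OF f m(3)])
  show "graded_length (koszul_sign (q * r) (gerst q (gerst r f h) g - gerst (q + r) f (gerst q h g)))"
    using len[OF m(2) g] len[OF f m(4)] by (simp add: graded_length_def koszul_sign_fun)
  have ml: "multilinear s s (suspension A) (suspension A) p (flat f)"
    "multilinear s s (suspension A) (suspension A) q (flat g)"
    "multilinear s s (suspension A) (suspension A) r (flat h)"
    "multilinear s s (suspension A) (suspension A) (p + q) (flat (gerst q f g))"
    "multilinear s s (suspension A) (suspension A) (p + r) (flat (gerst r f h))"
    "multilinear s s (suspension A) (suspension A) (q + r) (flat (gerst r g h))"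
    "multilinear s s (suspension A) (suspension A) (q + r) (flat (gerst q h g))"
    using f g h m by (simp_all add: CC_iff)
  have diff: "flat (x - y) w = flat x w - flat y w" "flat (koszul_sign n x) w = koszul_sign n (flat x w)"
    for x y :: "('a, 'a) cochain" and w n
    by (simp_all add: flat_def koszul_sign_fun)
  show "flat (gerst r (gerst q f g) h - gerst (q + r) f (gerst r g h)) =
    flat (koszul_sign (q * r) (gerst q (gerst r f h) g - gerst (q + r) f (gerst q h g)))"
  proof
    fix w
    show "flat (gerst r (gerst q f g) h - gerst (q + r) f (gerst r g h)) w =
      flat (koszul_sign (q * r) (gerst q (gerst r f h) g - gerst (q + r) f (gerst q h g))) w"
    proof (cases "w \<in> words (suspension A)")
      case True
      show ?thesis
        unfolding diff flat_gerst[OF susp susp m(1) h] flat_gerst[OF susp susp f m(3)]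
          flat_gerst[OF susp susp m(2) g] flat_gerst[OF susp susp f m(4)]
          flat_gerst[OF susp susp f g] flat_gerst[OF susp susp f h] flat_gerst[OF susp susp g h] flat_gerst[OF susp susp h g]
        by (rule circ_pre_lie[OF susp ml(1-3) True])
    next
      case False
      show ?thesis
        unfolding diff flat_gerst[OF susp susp m(1) h] flat_gerst[OF susp susp f m(3)]
          flat_gerst[OF susp susp m(2) g] flat_gerst[OF susp susp f m(4)]
        using False by (simp add: circ_outside[OF susp ml(4) ml(3)] circ_outside[OF susp ml(5) ml(2)]
            circ_outside[OF susp ml(1) ml(6)] circ_outside[OF susp ml(1) ml(7)])
    qed
  qed
qed

section \<open>The graded Lie axioms from the pre-Lie identity\<close>

lemma gbracket_mem:
  assumes "f \<in> CC s s A A p" "g \<in> CC s s A A q"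
  shows "gbracket p q f g \<in> CC s s A A (p + q)"
  unfolding gbracket_def
  using gerst_mem[OF assms] gerst_mem[OF assms(2,1)]
  by (auto intro!: CC_mem(5) CC_mem(6) simp: add.commute)

lemma gerst_gbracket_left:
  "gerst r (gbracket p q x y) z = gerst r (gerst q x y) z - koszul_sign (p * q) (gerst r (gerst p y x) z)"
  by (simp add: gbracket_def gerst_diff_left gerst_koszul_sign_left)

lemma gerst_gbracket_right:
  assumes "x \<in> CC s s A A p" "y \<in> CC s s A A q" "z \<in> CC s s A A r"
  shows "gerst (q + r) x (gbracket q r y z) =
    gerst (q + r) x (gerst r y z) - koszul_sign (q * r) (gerst (q + r) x (gerst q z y))"
proof -
  have *: "gerst r y z \<in> CC s s A A (q + r)" "gerst q z y \<in> CC s s A A (q + r)"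
    using gerst_mem[OF assms(2,3)] gerst_mem[OF assms(3,2)] by (simp_all add: add.commute)
  show ?thesis
    unfolding gbracket_def
    by (simp add: gerst_diff_right[OF assms(1)] gerst_koszul_sign_right[OF assms(1)] * CC_mem(6))
qed

text \<open>Expanded, the identity has twelve iterated products, four for each leftmost factor. Each
  group of four is one instance of \<open>gerst_pre_lie\<close>, used to rewrite one of its
  products. Signs depend only on the parities of \<open>p\<close>, \<open>q\<close>,
  \<open>r\<close>, hence eight cases.\<close>

lemma gbracket_jacobi:
  assumes x: "x \<in> CC s s A A p" and y: "y \<in> CC s s A A q" and z: "z \<in> CC s s A A r"
  shows "gbracket p (q + r) x (gbracket q r y z) =
    gbracket (p + q) r (gbracket p q x y) z +
    koszul_sign (p * q) (gbracket q (p + r) y (gbracket p r x z))"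
  unfolding gbracket_def[of p "q + r"] gbracket_def[of "p + q" r] gbracket_def[of q "p + r"]
    gerst_gbracket_left gerst_gbracket_right[OF x y z] gerst_gbracket_right[OF y x z]
    gerst_gbracket_right[OF z x y]
    gerst_pre_lie[OF x y z, unfolded diff_eq_eq] gerst_pre_lie[OF y x z, unfolded diff_eq_eq]
    gerst_pre_lie[OF z x y, unfolded diff_eq_eq]
  by (cases "even p"; cases "even q"; cases "even r") (simp_all add: koszul_sign_def algebra_simps)

text \<open>Jacobi gives only three times this. For odd \<open>x\<close> the pre-Lie identity with
  three equal arguments says that twice the associator is 0, and the left side is minus twice the
  associator.\<close>

lemma gbracket_odd:
  assumes x: "x \<in> CC s s A A p" and p: "odd p"
  shows "gbracket p (p + p) x (gbracket p p x x) = 0"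
  using gerst_pre_lie[OF x x x] p
  unfolding gbracket_def[of p "p + p"] gerst_gbracket_left gerst_gbracket_right[OF x x x]
  by (simp add: koszul_sign_def algebra_simps)

lemma gbracket_bilinear:
  assumes "x \<in> CC s s A A p" "x' \<in> CC s s A A p" "y \<in> CC s s A A q" "y' \<in> CC s s A A q"
  shows "gbracket p q (x + x') y = gbracket p q x y + gbracket p q x' y"
    "gbracket p q x (y + y') = gbracket p q x y + gbracket p q x y'"
    "gbracket p q (cc_scale s c x) y = cc_scale s c (gbracket p q x y)"
    "gbracket p q x (cc_scale s c y) = cc_scale s c (gbracket p q x y)"
proof -
  interpret module "cc_scale s :: _ \<Rightarrow> ('a, 'a) cochain \<Rightarrow> _"
    by (intro module_cc_scale s)
  show "gbracket p q (x + x') y = gbracket p q x y + gbracket p q x' y"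
    "gbracket p q x (y + y') = gbracket p q x y + gbracket p q x y'"
    unfolding gbracket_def gerst_add_left gerst_add_right[OF assms(3,1,2)] gerst_add_right[OF assms(1,3,4)]
    by (simp_all add: koszul_sign_add)
  show "gbracket p q (cc_scale s c x) y = cc_scale s c (gbracket p q x y)"
    "gbracket p q x (cc_scale s c y) = cc_scale s c (gbracket p q x y)"
    unfolding gbracket_def gerst_scale_left[OF s] gerst_scale_right[OF assms(3,1)]
      gerst_scale_right[OF assms(1,3)]
    by (simp_all add: koszul_sign_def scale_right_diff_distrib scale_right_distrib)
qed

lemma gbracket_antisym:
  "gbracket p q x y = - koszul_sign (p * q) (gbracket q p y x)"
  by (simp add: gbracket_def koszul_sign_def mult.commute)

lemma graded_lie_algebra_CC: "graded_lie_algebra (cc_scale s) (CC s s A A) gbracket"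
  unfolding graded_lie_algebra_def
proof (intro conjI allI ballI impI)
  show "gbracket p p x x = 0" if "even p" for p x
    using that by (simp add: gbracket_def koszul_sign_def)
  show "gbracket p q x y = - koszul_sign (p * q) (gbracket q p y x)" for p q x y
    by (rule gbracket_antisym)
qed (rule graded_module_CC[OF s A] gbracket_mem gbracket_bilinear gbracket_jacobi gbracket_odd; assumption)+

end

section \<open>Cochains on the reduced part\<close>

context
  fixes s :: "'k::comm_ring_1 \<Rightarrow> 'a::ab_group_add \<Rightarrow> 'a" and A one \<epsilon>
  assumes split: "split_element s A one \<epsilon>"
begin

lemma split_module: "graded_module s A" "module s"
  using split by (simp_all add: split_element_def graded_module_def)

private lemma M: "graded_module s (suspension A)"
  using split_module(1) by (rule graded_module_suspension)

lemma one_mem: "one \<in> A 0"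
  using split by (simp add: split_element_def)

lemma eps_simps:
  "\<epsilon> 0 one = 1"
  "x \<in> A d \<Longrightarrow> y \<in> A d \<Longrightarrow> \<epsilon> d (x + y) = \<epsilon> d x + \<epsilon> d y"
  "x \<in> A d \<Longrightarrow> \<epsilon> d (s c x) = c * \<epsilon> d x"
  using split by (auto simp: split_element_def graded_hom_def)

lemma eps_zero: "\<epsilon> d 0 = 0"
  using eps_simps(2)[of 0 d 0] graded_module_mem(1)[OF split_module(1)] by simp

lemma eps_scale_one: "\<epsilon> 0 (s c one) = c"
  using eps_simps(1) eps_simps(3)[OF one_mem] by simp

lemma eps_scale_mem: "x \<in> A d \<Longrightarrow> s (\<epsilon> d x) one \<in> unit_submodule s one d"
  using split_element_eps_0[OF split, of x d] module.scale_zero_left[OF split_module(2)]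
  by (auto simp: unit_submodule_def)

lemma unit_submodule_subset: "unit_submodule s one d \<subseteq> A d"
  using one_mem graded_module_mem[OF split_module(1)] by (auto simp: unit_submodule_def)

lemma proj_reduced_mem:
  assumes "x \<in> A d"
  shows "proj_reduced s one \<epsilon> d x \<in> reduced A \<epsilon> d"
proof -
  interpret module s by (rule split_module)
  have *: "s (\<epsilon> d x) one \<in> A d"
    using eps_scale_mem[OF assms] unit_submodule_subset by blast
  have "\<epsilon> d (x - s (\<epsilon> d x) one) + \<epsilon> d (s (\<epsilon> d x) one) = \<epsilon> d x"
    using eps_simps(2)[of "x - s (\<epsilon> d x) one" d "s (\<epsilon> d x) one"] assms *
      graded_module_mem(5)[OF split_module(1)] by simp
  moreover have "\<epsilon> d (s (\<epsilon> d x) one) = \<epsilon> d x"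
    using split_element_eps_0[OF split assms] eps_scale_one by (cases "d = 0") (simp_all add: eps_zero)
  ultimately show ?thesis
    using assms * graded_module_mem(5)[OF split_module(1)] by (simp add: reduced_def proj_reduced_def)
qed

lemma proj_reduced_linear:
  assumes "x \<in> A d"
  shows "y \<in> A d \<Longrightarrow>
      proj_reduced s one \<epsilon> d (x + y) = proj_reduced s one \<epsilon> d x + proj_reduced s one \<epsilon> d y"
    "proj_reduced s one \<epsilon> d (s c x) = s c (proj_reduced s one \<epsilon> d x)"
proof -
  interpret module s by (rule split_module)
  show "y \<in> A d \<Longrightarrow>
      proj_reduced s one \<epsilon> d (x + y) = proj_reduced s one \<epsilon> d x + proj_reduced s one \<epsilon> d y"
    "proj_reduced s one \<epsilon> d (s c x) = s c (proj_reduced s one \<epsilon> d x)"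
    using assms by (simp_all add: proj_reduced_def eps_simps scale_left_distrib scale_right_diff_distrib)
qed

lemma proj_reduced_simps:
  "proj_reduced s one \<epsilon> 0 one = 0"
  "x \<in> A d \<Longrightarrow> d \<noteq> 0 \<Longrightarrow> proj_reduced s one \<epsilon> d x = x"
  "x \<in> reduced A \<epsilon> d \<Longrightarrow> proj_reduced s one \<epsilon> d x = x"
proof -
  interpret module s by (rule split_module)
  show "proj_reduced s one \<epsilon> 0 one = 0"
    "x \<in> A d \<Longrightarrow> d \<noteq> 0 \<Longrightarrow> proj_reduced s one \<epsilon> d x = x"
    "x \<in> reduced A \<epsilon> d \<Longrightarrow> proj_reduced s one \<epsilon> d x = x"
    using split_element_eps_0[OF split, of x d]
    by (auto simp: proj_reduced_def reduced_def eps_simps)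
qed

lemma graded_module_reduced: "graded_module s (reduced A \<epsilon>)"
proof -
  interpret module s by (rule split_module)
  show ?thesis
    unfolding graded_module_def using graded_module_mem[OF split_module(1)]
    by (auto intro!: subspaceI module_axioms simp: reduced_def eps_simps eps_zero)
qed

lemma graded_module_unit_submodule: "graded_module s (unit_submodule s one)"
proof -
  interpret module s by (rule split_module)
  have "subspace (range (\<lambda>c. s c one))"
  proof (rule subspaceI)
    show "0 \<in> range (\<lambda>c. s c one)" by (metis rangeI scale_zero_left)
    show "x + y \<in> range (\<lambda>c. s c one)" if "x \<in> range (\<lambda>c. s c one)" "y \<in> range (\<lambda>c. s c one)" for x y
      using that by (auto simp flip: scale_left_distrib)
  qed auto
  then show ?thesis
    unfolding graded_module_def
    by (auto intro!: subspaceI module_axioms simp: unit_submodule_def subspace_0 subspace_add subspace_scale)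
qed

private abbreviation (input) "proj_word \<equiv> map (\<lambda>(d, x). (d, proj_reduced s one \<epsilon> (d - 1) x))"

private lemma proj_word:
  "w \<in> words (suspension A) \<Longrightarrow> proj_word w \<in> words (suspension (reduced A \<epsilon>))"
  "wdeg (proj_word w) = wdeg w"
  by (induction w) (auto simp: suspension_def proj_reduced_mem)

private lemma reduced_words: "w \<in> words (suspension (reduced A \<epsilon>)) \<Longrightarrow> w \<in> words (suspension A)"
  by (auto simp: words_def suspension_def reduced_def)

private lemma flat_extend_cochain:
  "flat (extend_cochain s A one \<epsilon> f) w =
     (if w \<in> words (suspension A) then flat f (proj_word w) else 0)"
  by (simp add: flat_def extend_cochain_def hwords_iff)

text \<open>The projection is linear of degree 0, so multilinearity survives; it sends
  \<open>one\<close> to 0, and a multilinear map vanishes on a word with a zero entry.\<close>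

lemma extend_cochain_mem:
  assumes B: "graded_module s B" and f: "f \<in> CC s s (reduced A \<epsilon>) B p"
  shows "extend_cochain s A one \<epsilon> f \<in> CC s s A B p"
    "(1, one) \<in> set w \<Longrightarrow> flat (extend_cochain s A one \<epsilon> f) w = 0"
proof -
  have F: "multilinear s s (suspension (reduced A \<epsilon>)) (suspension B) p (flat f)"
    using f by (simp add: CC_iff)
  have proj: "proj_reduced s one \<epsilon> (d - 1) x \<in> suspension (reduced A \<epsilon>) d"
    if "x \<in> suspension A d" for x d
    using that proj_reduced_mem by (simp add: suspension_def)
  note lin = proj_reduced_linear[of _ "d - 1" for d, folded suspension_def]
  show "extend_cochain s A one \<epsilon> f \<in> CC s s A B p"
    unfolding CC_iff
  proof (intro conjI multilinearI)
    show "graded_length (extend_cochain s A one \<epsilon> f)"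
      by (simp add: graded_length_def extend_cochain_def hwords_iff)
    fix w assume "w \<in> words (suspension A)" "w \<noteq> []"
    then show "flat (extend_cochain s A one \<epsilon> f) w \<in> suspension B (wdeg w + p)"
      using multilinear_mem[OF F proj_word(1)] by (simp add: flat_extend_cochain proj_word(2))
  qed (simp_all add: flat_extend_cochain multilinear_Nil[OF F] proj_word lin proj
      multilinear_add[OF F] multilinear_scale[OF F] graded_module_mem[OF M])
  assume "(1, one) \<in> set w"
  then obtain u v where "w = u @ (1, one) # v"
    by (meson split_list)
  then show "flat (extend_cochain s A one \<epsilon> f) w = 0"
    using multilinear_zero[OF graded_module_suspension[OF graded_module_reduced]
        graded_module_suspension[OF B] F]
    by (simp add: flat_extend_cochain proj_reduced_simps(1))
qed

text \<open>Entries are projected one at a time, with \<open>u\<close> absorbing those already done.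
  Each step changes an entry by a multiple of \<open>one\<close>, which \<open>f\<close> kills; by
  degree, only entries with \<open>d = 1\<close> change at all.\<close>

lemma flat_proj_word:
  assumes B: "graded_module s B" and f: "f \<in> CC s s A B p"
    and f_one: "\<And>w. (1, one) \<in> set w \<Longrightarrow> flat f w = 0"
    and "u \<in> words (suspension A)" "v \<in> words (suspension A)"
  shows "flat f (u @ proj_word v) = flat f (u @ v)"
  using assms(4,5)
proof (induction v arbitrary: u)
  case (Cons y v)
  interpret module s by (rule split_module)
  have F: "multilinear s s (suspension A) (suspension B) p (flat f)"
    using f by (simp add: CC_iff)
  obtain d x where y: "y = (d, x)" by (cases y)
  let ?x = "proj_reduced s one \<epsilon> (d - 1) x"
  have x: "x \<in> suspension A d" and v: "v \<in> words (suspension A)"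
    using Cons.prems y by auto
  have x': "?x \<in> suspension A d"
    using x proj_reduced_mem[of x "d - 1"] by (simp add: suspension_def reduced_def)
  have "flat f (u @ (d, ?x) # proj_word v) = flat f (u @ (d, ?x) # v)"
    using Cons.IH[of "u @ [(d, ?x)]"] Cons.prems x' v by simp
  also have "\<dots> = flat f (u @ (d, x) # v)"
  proof (cases "d = 1")
    case True
    have one: "one \<in> suspension A 1" using one_mem by (simp add: suspension_def)
    have "flat f (u @ (d, ?x + s (\<epsilon> 0 x) one) # v) =
        flat f (u @ (d, ?x) # v) + s (\<epsilon> 0 x) (flat f (u @ (d, one) # v))"
      using True Cons.prems v x' one graded_module_mem(3)[OF M one]
      by (simp add: multilinear_add[OF F] multilinear_scale[OF F])
    then show ?thesis
      using True f_one by (simp add: proj_reduced_def)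
  qed (use x proj_reduced_simps(2) in \<open>simp add: suspension_def\<close>)
  finally show ?case by (simp add: y)
qed simp

lemma CC_reduced_iff:
  assumes B: "graded_module s B"
  shows "f \<in> CC_reduced s A one \<epsilon> B p \<longleftrightarrow>
    f \<in> CC s s A B p \<and> (\<forall>w. (1, one) \<in> set w \<longrightarrow> flat f w = 0)"
proof
  assume f: "f \<in> CC s s A B p \<and> (\<forall>w. (1, one) \<in> set w \<longrightarrow> flat f w = 0)"
  then have F: "multilinear s s (suspension A) (suspension B) p (flat f)"
    and len: "graded_length f"
    by (simp_all add: CC_iff)
  \<comment> \<open>The preimage under the pullback: \<open>f\<close> restricted to reduced words
    and, as \<open>tensor_hom\<close> requires, 0 elsewhere. That its pullback is \<open>f\<close>
    is \<open>flat_proj_word\<close> with empty prefix.\<close>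
  define g where "g = (\<lambda>n w. if w \<in> words (suspension (reduced A \<epsilon>)) then f n w else 0)"
  have flat_g: "flat g w = (if w \<in> words (suspension (reduced A \<epsilon>)) then flat f w else 0)" for w
    by (simp add: g_def flat_def)
  have red: "x \<in> suspension A d" if "x \<in> suspension (reduced A \<epsilon>) d" for x d
    using that by (simp add: suspension_def reduced_def)
  have "g \<in> CC s s (reduced A \<epsilon>) B p"
    unfolding CC_iff
  proof (intro conjI multilinearI)
    show "graded_length g"
      using len by (simp add: graded_length_def g_def)
  qed (simp_all add: flat_g multilinear_Nil[OF F] multilinear_mem[OF F] reduced_words red
      multilinear_add[OF F] multilinear_scale[OF F]
      graded_module_mem[OF graded_module_suspension[OF graded_module_reduced]])
  moreover have "extend_cochain s A one \<epsilon> g = f"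
  proof (rule flat_eqI[OF _ len])
    show "graded_length (extend_cochain s A one \<epsilon> g)"
      by (simp add: graded_length_def extend_cochain_def hwords_iff)
    show "flat (extend_cochain s A one \<epsilon> g) = flat f"
      using flat_proj_word[OF B, of f p "[]"] f multilinear_outside[OF F]
      by (auto simp: fun_eq_iff flat_extend_cochain flat_g proj_word)
  qed
  ultimately show "f \<in> CC_reduced s A one \<epsilon> B p"
    by (auto simp: CC_reduced_def)
qed (auto simp: CC_reduced_def extend_cochain_mem[OF B])

lemma graded_module_CC_reduced:
  assumes B: "graded_module s B"
  shows "graded_module (cc_scale s) (CC_reduced s A one \<epsilon> B)"
proof -
  interpret s: module s by (rule split_module)
  interpret module "cc_scale s :: _ \<Rightarrow> ('a, 'a) cochain \<Rightarrow> _"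
    by (intro module_cc_scale s.module_axioms)
  note mem = graded_module_mem[OF graded_module_CC[OF split_module(2) B]]
  show ?thesis
    unfolding graded_module_def
    by (intro conjI allI module_axioms subspaceI)
      (auto simp: CC_reduced_iff[OF B] mem flat_simps)
qed

lemma CC_reduced_mono:
  assumes "graded_module s B" "\<And>d. B d \<subseteq> A d" "f \<in> CC_reduced s A one \<epsilon> B p"
  shows "f \<in> CC_reduced s A one \<epsilon> A p"
  using assms(2,3) unfolding CC_reduced_iff[OF assms(1)] CC_reduced_iff[OF split_module(1)] CC_iff
    multilinear_def suspension_def by blast

text \<open>In each term the unit is either an entry of the outer word, where \<open>g\<close>
  vanishes, or lies in the block, where \<open>f\<close> is 0 and \<open>g\<close> receives a zero
  entry.\<close>

lemma gerst_CC_reduced: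
  assumes g: "g \<in> CC_reduced s A one \<epsilon> A q" and f: "f \<in> CC_reduced s A one \<epsilon> A p"
  shows "gerst p g f \<in> CC_reduced s A one \<epsilon> A (q + p)"
proof -
  have g': "g \<in> CC s s A A q" "\<And>w. (1, one) \<in> set w \<Longrightarrow> flat g w = 0"
    and f': "f \<in> CC s s A A p" "\<And>w. (1, one) \<in> set w \<Longrightarrow> flat f w = 0"
    using f g by (auto simp: CC_reduced_iff[OF split_module(1)])
  have G: "multilinear s s (suspension A) (suspension A) q (flat g)"
    using g' by (simp add: CC_iff)
  have "circ p (flat g) (flat f) (u @ (1, one) # t) = 0" for u t
    unfolding circ_append_Cons by (simp add: f'(2) g'(2) multilinear_zero[OF M M G] cut_sum_eq_0)
  then have "circ p (flat g) (flat f) w = 0" if "(1, one) \<in> set w" for w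
    using that by (metis split_list)
  then show ?thesis
    using gerst_mem[OF split_module(1) g'(1) f'(1)]
    by (simp add: CC_reduced_iff[OF split_module(1)] flat_gerst[OF M M g'(1) f'(1)])
qed

lemma gbracket_CC_reduced:
  assumes "f \<in> CC_reduced s A one \<epsilon> A p" "g \<in> CC_reduced s A one \<epsilon> A q"
  shows "gbracket p q f g \<in> CC_reduced s A one \<epsilon> A (p + q)"
  unfolding gbracket_def
  using gerst_CC_reduced[OF assms] gerst_CC_reduced[OF assms(2,1)]
    graded_module_mem[OF graded_module_CC_reduced[OF split_module(1)]]
  by (simp add: add.commute)

section \<open>Splitting the values into reduced part and unit part\<close>

lemma bij_betw_CC_reduced_sum:
  "bij_betw (\<lambda>(\<mu>, h). \<mu> + h)
     (CC_reduced s A one \<epsilon> (reduced A \<epsilon>) p \<times> CC_reduced s A one \<epsilon> (unit_submodule s one) p)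
     (CC_reduced s A one \<epsilon> A p)"
proof (rule bij_betw_imageI)
  interpret module s by (rule split_module)
  note R = CC_reduced_iff[OF graded_module_reduced] and U = CC_reduced_iff[OF graded_module_unit_submodule]
    and A = CC_reduced_iff[OF split_module(1)]
  note sub = CC_reduced_mono[OF graded_module_reduced] CC_reduced_mono[OF graded_module_unit_submodule]
  have inter: "x = 0" if "x \<in> reduced A \<epsilon> d" "x \<in> unit_submodule s one d" for x d
    using that eps_scale_one by (auto simp: reduced_def unit_submodule_def split: if_splits)
  show "inj_on (\<lambda>(\<mu>, h). \<mu> + h)
     (CC_reduced s A one \<epsilon> (reduced A \<epsilon>) p \<times> CC_reduced s A one \<epsilon> (unit_submodule s one) p)"
  proof (rule inj_onI, clarsimp)
    fix \<mu> h \<mu>' h'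
    assume *: "\<mu> \<in> CC_reduced s A one \<epsilon> (reduced A \<epsilon>) p" "\<mu>' \<in> CC_reduced s A one \<epsilon> (reduced A \<epsilon>) p"
      "h \<in> CC_reduced s A one \<epsilon> (unit_submodule s one) p" "h' \<in> CC_reduced s A one \<epsilon> (unit_submodule s one) p"
      and eq: "\<mu> + h = \<mu>' + h'"
    \<comment> \<open>The left side has values in the reduced part, the right side in the multiples
      of \<open>one\<close>; these meet only in 0.\<close>
    then have eq': "\<mu> - \<mu>' = h' - h" by (simp add: algebra_simps)
    have "\<mu> - \<mu>' \<in> CC s s A (reduced A \<epsilon>) p" "h' - h \<in> CC s s A (unit_submodule s one) p"
      using * graded_module_mem(5)[OF graded_module_CC[OF split_module(2) graded_module_reduced]]
        graded_module_mem(5)[OF graded_module_CC[OF split_module(2) graded_module_unit_submodule]]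
      by (simp_all add: R U)
    then have D: "\<mu> - \<mu>' \<in> CC s s A (reduced A \<epsilon>) p" "\<mu> - \<mu>' \<in> CC s s A (unit_submodule s one) p"
      by (simp_all only: eq')
    have D': "multilinear s s (suspension A) (suspension (reduced A \<epsilon>)) p (flat (\<mu> - \<mu>'))"
      "multilinear s s (suspension A) (suspension (unit_submodule s one)) p (flat (\<mu> - \<mu>'))"
      using D by (simp_all only: CC_iff)
    have zero: "flat (\<mu> - \<mu>') w = 0" for w
    proof (cases "w \<noteq> [] \<and> w \<in> words (suspension A)")
      case True
      then show ?thesis
        using multilinear_mem[OF D'(1), of w] multilinear_mem[OF D'(2), of w]
        by (intro inter) (simp_all add: suspension_def)
    qed (use multilinear_outside[OF D'(1)] multilinear_Nil[OF D'(1)] in auto)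
    have "\<mu> - \<mu>' = 0"
    proof (rule flat_eqI)
      show "graded_length (\<mu> - \<mu>')" using D by (simp add: CC_iff)
      show "graded_length (0 :: ('a, 'a) cochain)" by (simp add: graded_length_def)
      show "flat (\<mu> - \<mu>') = flat 0" by (simp add: zero fun_eq_iff flat_simps)
    qed
    then show "\<mu> = \<mu>' \<and> h = h'" using eq by simp
  qed
  show "(\<lambda>(\<mu>, h). \<mu> + h) ` (CC_reduced s A one \<epsilon> (reduced A \<epsilon>) p \<times>
      CC_reduced s A one \<epsilon> (unit_submodule s one) p) = CC_reduced s A one \<epsilon> A p"
  proof (intro equalityI subsetI)
    fix f assume f: "f \<in> CC_reduced s A one \<epsilon> A p"
    then have F: "multilinear s s (suspension A) (suspension A) p (flat f)" and len: "graded_length f"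
      and f_one: "\<And>w. (1, one) \<in> set w \<Longrightarrow> flat f w = 0"
      by (simp_all add: A CC_iff)
    \<comment> \<open>The two components of the values. A value on \<open>w\<close> has degree
      \<open>wdeg w + p\<close> in the suspension, so \<open>\<epsilon>\<close> is taken in degree
      \<open>wdeg w + p - 1\<close>.\<close>
    define \<mu> h where "\<mu> = (\<lambda>n w. proj_reduced s one \<epsilon> (wdeg w + p - 1) (f n w))"
      and "h = (\<lambda>n w. s (\<epsilon> (wdeg w + p - 1) (f n w)) one)"
    have flat: "flat \<mu> w = proj_reduced s one \<epsilon> (wdeg w + p - 1) (flat f w)"
      "flat h w = s (\<epsilon> (wdeg w + p - 1) (flat f w)) one" for w
      by (simp_all add: \<mu>_def h_def flat_def)
    have zero: "proj_reduced s one \<epsilon> d 0 = 0" for d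
      by (simp add: proj_reduced_def eps_zero)
    have F_mem: "flat f (u @ (d, x) # v) \<in> A (wdeg u + (d + wdeg v) + p - 1)"
      if "u \<in> words (suspension A)" "v \<in> words (suspension A)" "x \<in> suspension A d" for u v x d
      using multilinear_mem[OF F, of "u @ (d, x) # v"] that by (simp add: suspension_def)
    have "\<mu> \<in> CC_reduced s A one \<epsilon> (reduced A \<epsilon>) p"
      unfolding R CC_iff
    proof (intro conjI multilinearI allI impI)
      show "graded_length \<mu>" using len by (simp add: graded_length_def \<mu>_def zero)
      fix w assume "w \<in> words (suspension A)" "w \<noteq> []"
      then show "flat \<mu> w \<in> suspension (reduced A \<epsilon>) (wdeg w + p)"
        using multilinear_mem[OF F] proj_reduced_mem by (simp add: flat suspension_def)
    qed (simp_all add: flat zero multilinear_Nil[OF F] multilinear_outside[OF F] multilinear_add[OF F]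
        multilinear_scale[OF F] f_one proj_reduced_linear F_mem)
    moreover have "h \<in> CC_reduced s A one \<epsilon> (unit_submodule s one) p"
      unfolding U CC_iff
    proof (intro conjI multilinearI allI impI)
      show "graded_length h" using len by (simp add: graded_length_def h_def eps_zero)
      fix w assume "w \<in> words (suspension A)" "w \<noteq> []"
      then show "flat h w \<in> suspension (unit_submodule s one) (wdeg w + p)"
        using multilinear_mem[OF F] eps_scale_mem by (simp add: flat suspension_def)
    qed (simp_all add: flat eps_zero multilinear_Nil[OF F] multilinear_outside[OF F] multilinear_add[OF F]
        multilinear_scale[OF F] f_one eps_simps F_mem scale_left_distrib)
    moreover have "f = \<mu> + h"
      by (simp add: fun_eq_iff \<mu>_def h_def proj_reduced_def)
    ultimately show "f \<in> (\<lambda>(\<mu>, h). \<mu> + h) ` (CC_reduced s A one \<epsilon> (reduced A \<epsilon>) p \<times>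
      CC_reduced s A one \<epsilon> (unit_submodule s one) p)"
      by blast
  qed (use sub unit_submodule_subset
      graded_module_mem(2)[OF graded_module_CC_reduced[OF split_module(1)]] in \<open>auto simp: reduced_def\<close>)
qed


section \<open>The trivial strictly unital structure\<close>

private abbreviation (input) "\<mu> \<equiv> mu_su s A one \<epsilon>"

lemma flat_mu_su:
  "flat \<mu> [(d, a), (e, b)] =
    (if a \<in> A (d - 1) \<and> b \<in> A (e - 1)
     then s (\<epsilon> (d - 1) a) b + koszul_sign (d - 1) (s (\<epsilon> (e - 1) b) (proj_reduced s one \<epsilon> (d - 1) a))
     else 0)"
  by (simp add: flat_def mu_su_def hwords_2 Let_def flip: numeral_2_eq_2)

lemma flat_mu_su_length: "length w \<noteq> 2 \<Longrightarrow> flat \<mu> w = 0"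
  by (simp add: flat_def mu_su_def)

lemma flat_mu_su_one:
  assumes "a \<in> A (d - 1)"
  shows "flat \<mu> [(1, one), (d, a)] = a" "flat \<mu> [(d, a), (1, one)] = koszul_sign (d - 1) a"
  using mu_su_unit_left[OF split assms] mu_su_unit_right[OF split assms]
  by (simp_all add: flat_def flip: numeral_2_eq_2)

lemma mu_su_mem: "\<mu> \<in> CC s s A A (-1)"
proof -
  interpret module s by (rule split_module)
  note A = graded_module_mem[OF split_module(1)]
  have red: "proj_reduced s one \<epsilon> d a \<in> A d" if "a \<in> A d" for a d
    using proj_reduced_mem[OF that] by (simp add: reduced_def)
  have two: "\<exists>d a e b. w = [(d, a), (e, b)]" if "length w = 2" for w :: "'a hword"
    using that by (auto simp: length_Suc_conv numeral_2_eq_2)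
  \<comment> \<open>A marked entry in a word of length 2 has exactly one neighbour, before or after
    it; on other lengths \<open>mu_su\<close> is 0. As an elimination rule this serves both
    linearity clauses.\<close>
  have short: thesis
    if "length (u @ y # v) \<noteq> 2 \<Longrightarrow> thesis" "\<And>e b. u = [(e, b)] \<Longrightarrow> v = [] \<Longrightarrow> thesis"
      "\<And>e b. u = [] \<Longrightarrow> v = [(e, b)] \<Longrightarrow> thesis" for thesis and u v :: "'a hword" and y
  proof (cases "length (u @ y # v) = 2")
    case True
    then obtain d a e b where "u @ y # v = [(d, a), (e, b)]" using two by blast
    then show thesis using that(2,3) by (auto simp: append_eq_Cons_conv Cons_eq_append_conv)
  qed (rule that(1))
  note lin = eps_simps(2,3) proj_reduced_linear
  show ?thesis
    unfolding CC_iff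
  proof (intro conjI multilinearI)
    show "graded_length \<mu>"
      by (auto simp: graded_length_def mu_su_def hwords_iff)
    show "flat \<mu> [] = 0" by (simp add: flat_mu_su_length)
    show "flat \<mu> w = 0" if "w \<notin> words (suspension A)" for w
      using that by (simp add: flat_def mu_su_def hwords_iff)
  next
    fix w assume w: "w \<in> words (suspension A)"
    show "flat \<mu> w \<in> suspension A (wdeg w + - 1)"
    proof (cases "length w = 2")
      case True
      then obtain d a e b where wdef: "w = [(d, a), (e, b)]" using two by blast
      with w have ab: "a \<in> A (d - 1)" "b \<in> A (e - 1)" by (simp_all add: suspension_def)
      \<comment> \<open>Unless \<open>d = 1\<close> the coefficient is 0, and for
        \<open>d = 1\<close> the element \<open>b\<close> already has degree
        \<open>d + e - 2\<close>.\<close>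
      have "s (\<epsilon> (d - 1) a) b \<in> A (d + e - 2)"
        using split_element_eps_0[OF split ab(1)] ab A by (cases "d = 1") auto
      moreover have "koszul_sign (d - 1) (s (\<epsilon> (e - 1) b) (proj_reduced s one \<epsilon> (d - 1) a)) \<in> A (d + e - 2)"
        using split_element_eps_0[OF split ab(2)] red[OF ab(1)] A by (cases "e = 1") auto
      ultimately show ?thesis
        using ab A by (simp add: wdef flat_mu_su suspension_def)
    qed (use flat_mu_su_length A in \<open>simp add: suspension_def\<close>)
  next
    fix u v d x y
    assume *: "u \<in> words (suspension A)" "v \<in> words (suspension A)" "x \<in> suspension A d" "y \<in> suspension A d"
    show "flat \<mu> (u @ (d, x + y) # v) = flat \<mu> (u @ (d, x) # v) + flat \<mu> (u @ (d, y) # v)"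
    proof (cases rule: short[of u "(d, x)" v])
      case 1
      then show ?thesis by (simp add: flat_mu_su_length)
    next
      case (2 e b)
      then show ?thesis
        using * A by (simp add: flat_mu_su suspension_def lin koszul_sign_add scale_left_distrib scale_right_distrib)
    next
      case (3 e b)
      then show ?thesis
        using * A by (simp add: flat_mu_su suspension_def lin koszul_sign_add scale_left_distrib scale_right_distrib)
    qed
  next
    fix u v d x c
    assume *: "u \<in> words (suspension A)" "v \<in> words (suspension A)" "x \<in> suspension A d"
    show "flat \<mu> (u @ (d, s c x) # v) = s c (flat \<mu> (u @ (d, x) # v))"
    proof (cases rule: short[of u "(d, x)" v])
      case 1
      then show ?thesis by (simp add: flat_mu_su_length)
    next
      case (2 e b)
      then show ?thesis
        using * A by (simp add: flat_mu_su suspension_def lin koszul_sign_def scale_right_distrib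
            scale_right_diff_distrib mult.commute)
    next
      case (3 e b)
      then show ?thesis
        using * A by (simp add: flat_mu_su suspension_def lin koszul_sign_def scale_right_distrib
            scale_right_diff_distrib mult.commute)
    qed
  qed
qed

private lemma mu: "multilinear s s (suspension A) (suspension A) (- 1) (flat \<mu>)"
  using mu_su_mem by (simp add: CC_iff)

text \<open>The splitting is multiplicative for the trivial product, because the second summand in
  \<open>mu_su\<close> is a multiple of a projected element and lies in the kernel of
  \<open>\<epsilon>\<close>. The cases arise since the degree index of \<open>\<epsilon>\<close>
  fits \<open>b\<close> only for \<open>d = 1\<close> and \<open>a\<close> only for
  \<open>e = 1\<close>.\<close>

lemma eps_mu_su:
  assumes a: "a \<in> A (d - 1)" and b: "b \<in> A (e - 1)"
  shows "\<epsilon> (d + e - 2) (flat \<mu> [(d, a), (e, b)]) = \<epsilon> (d - 1) a * \<epsilon> (e - 1) b"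
proof -
  interpret module s by (rule split_module)
  let ?a = "proj_reduced s one \<epsilon> (d - 1) a"
  have a': "?a \<in> A (d - 1)" "\<epsilon> (d - 1) ?a = 0"
    using proj_reduced_mem[OF a] by (simp_all add: reduced_def)
  note A = graded_module_mem[OF split_module(1)]
  consider "d = 1" | "d \<noteq> 1" "e = 1" | "d \<noteq> 1" "e \<noteq> 1" by blast
  then show ?thesis
  proof cases
    case 1
    show ?thesis
    proof (cases "e = 1")
      case True
      then show ?thesis
        using 1 a b a' A by (simp add: flat_mu_su koszul_sign_def eps_simps)
    next
      case False
      then show ?thesis
        using 1 a b A split_element_eps_0[OF split b]
        by (simp add: flat_mu_su eps_simps)
    qed
  next
    case 2
    have "\<epsilon> (d - 1) (koszul_sign (d - 1) (s (\<epsilon> 0 b) ?a)) = 0"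
      using a' eps_simps(3)[OF a'(1), of "\<epsilon> 0 b"] eps_simps(3)[OF a'(1), of "- \<epsilon> 0 b"]
      by (simp add: koszul_sign_def)
    then show ?thesis
      using 2 a b split_element_eps_0[OF split a] by (simp add: flat_mu_su)
  next
    case 3
    then show ?thesis
      using a b split_element_eps_0[OF split a] split_element_eps_0[OF split b]
      by (simp add: flat_mu_su eps_zero)
  qed
qed

text \<open>This is associativity of the unital product in which reduced elements multiply to 0.
  Only words of length 3 can contribute, through the blocks [a|b] and [b|c].\<close>

lemma gerst_mu_su_mu_su: "gerst (- 1) \<mu> \<mu> = 0"
proof (rule flat_eqI)
  show "graded_length (gerst (- 1) \<mu> \<mu>)"
    by (rule graded_length_gerst[OF M M mu_su_mem mu_su_mem])
  show "graded_length (0 :: ('a, 'a) cochain)" by (simp add: graded_length_def)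
  interpret module s by (rule split_module)
  have "circ (- 1) (flat \<mu>) (flat \<mu>) w = 0" if w: "w \<in> words (suspension A)" for w
  proof (cases "length w = 3")
    case True
    then obtain d a e b f c where wdef: "w = [(d, a), (e, b), (f, c)]"
      by (auto simp: length_Suc_conv numeral_3_eq_3)
    with w have abc: "a \<in> A (d - 1)" "b \<in> A (e - 1)" "c \<in> A (f - 1)" by (simp_all add: suspension_def)
    \<comment> \<open>The second block starts after \<open>a\<close>, so the inner map of degree -1
      moves past an entry of degree \<open>d\<close>.\<close>
    have "circ (- 1) (flat \<mu>) (flat \<mu>) w =
      flat \<mu> [(d + e - 1, flat \<mu> [(d, a), (e, b)]), (f, c)] +
      koszul_sign d (flat \<mu> [(d, a), (e + f - 1, flat \<mu> [(e, b), (f, c)])])"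
      by (simp add: wdef circ_def flat_mu_su_length koszul_sign_def)
    also have "\<dots> = 0"
    proof -
      define \<alpha> \<beta> \<gamma> a' b' where "\<alpha> = \<epsilon> (d - 1) a" and "\<beta> = \<epsilon> (e - 1) b" and "\<gamma> = \<epsilon> (f - 1) c"
        and "a' = proj_reduced s one \<epsilon> (d - 1) a" and "b' = proj_reduced s one \<epsilon> (e - 1) b"
      have ab: "flat \<mu> [(d, a), (e, b)] = s \<alpha> b + koszul_sign (d - 1) (s \<beta> a')"
        and bc: "flat \<mu> [(e, b), (f, c)] = s \<beta> c + koszul_sign (e - 1) (s \<gamma> b')"
        using abc by (simp_all add: flat_mu_su \<alpha>_def \<beta>_def \<gamma>_def a'_def b'_def)
      have ab_mem: "flat \<mu> [(d, a), (e, b)] \<in> A (d + e - 2)" and bc_mem: "flat \<mu> [(e, b), (f, c)] \<in> A (e + f - 2)"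
        using multilinear_mem[OF mu, of "[(d, a), (e, b)]"] multilinear_mem[OF mu, of "[(e, b), (f, c)]"] abc
        by (simp_all add: suspension_def algebra_simps)
      \<comment> \<open>These settle the signs: a term with factor \<open>\<alpha>\<close> survives
        only for \<open>d = 1\<close> and one with factor \<open>\<beta>\<close> only for
        \<open>e = 1\<close>, where the parity is known.\<close>
      have zero: "d \<noteq> 1 \<Longrightarrow> \<alpha> = 0" "e \<noteq> 1 \<Longrightarrow> \<beta> = 0"
        using split_element_eps_0[OF split abc(1)] split_element_eps_0[OF split abc(2)]
        by (simp_all add: \<alpha>_def \<beta>_def)
      have "proj_reduced s one \<epsilon> (d + e - 2) (flat \<mu> [(d, a), (e, b)]) =
          s \<alpha> b' + koszul_sign (d - 1) (s \<beta> a')"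
        unfolding proj_reduced_def[of s one \<epsilon> "d + e - 2"] eps_mu_su[OF abc(1,2)] unfolding ab
        by (simp add: b'_def proj_reduced_def algebra_simps flip: \<alpha>_def \<beta>_def)
      then have "flat \<mu> [(d + e - 1, flat \<mu> [(d, a), (e, b)]), (f, c)] =
          s (\<alpha> * \<beta>) c + koszul_sign (d + e) (s \<gamma> (s \<alpha> b' + koszul_sign (d - 1) (s \<beta> a')))"
        using ab_mem abc by (simp add: flat_mu_su[of "d + e - 1"] eps_mu_su \<gamma>_def)
          (simp add: \<alpha>_def \<beta>_def koszul_sign_def)
      moreover have "flat \<mu> [(d, a), (e + f - 1, flat \<mu> [(e, b), (f, c)])] =
          s \<alpha> (s \<beta> c + koszul_sign (e - 1) (s \<gamma> b')) + koszul_sign (d - 1) (s (\<beta> * \<gamma>) a')"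
        using bc_mem abc unfolding bc[symmetric] unfolding \<alpha>_def \<beta>_def \<gamma>_def a'_def
        by (simp add: flat_mu_su[of d a "e + f - 1"] eps_mu_su)
      ultimately show ?thesis
        using zero by (cases "d = 1"; cases "e = 1"; cases "even d"; cases "even e")
          (simp_all add: koszul_sign_def algebra_simps)
    qed
    finally show ?thesis .
  next
    case False
    show ?thesis
      unfolding circ_def
    proof (intro cut_sum_eq_0)
      fix u x v t assume "w = u @ x" "x = v @ t"
      then have "length v \<noteq> 2 \<or> length (u @ (wdeg v + - 1, flat \<mu> v) # t) \<noteq> 2"
        using False by auto
      then have "flat \<mu> (u @ (wdeg v + - 1, flat \<mu> v) # t) = 0"
        using flat_mu_su_length[of v] flat_mu_su_length[of "u @ (wdeg v + - 1, flat \<mu> v) # t"]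
          multilinear_zero[OF M M mu] by auto
      then show "koszul_sign (- 1 * wdeg u) (flat \<mu> (u @ (wdeg v + - 1, flat \<mu> v) # t)) = 0"
        by simp
    qed
  qed
  then show "flat (gerst (- 1) \<mu> \<mu>) = flat 0"
    using circ_outside[OF M mu mu]
    by (auto simp: fun_eq_iff flat_simps flat_gerst[OF M M mu_su_mem mu_su_mem])
qed

section \<open>Products with the trivial structure on words containing [1]\<close>

text \<open>\<open>f\<close> vanishes if [1] is left over, so the block contains it, and
  \<open>mu_su\<close> accepts only blocks of length 2. What remains is [1] with the first entry of
  \<open>t\<close>, or the last entry of \<open>u\<close> with [1]. Both give back
  \<open>u @ t\<close>; the right unit law contributes the degree of that last entry minus 1 to the
  sign, which makes the second term negative.\<close>

lemma circ_mu_su_right: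
  assumes f: "f \<in> CC_reduced s A one \<epsilon> A p" and w: "u @ t \<in> words (suspension A)"
  shows "circ (- 1) (flat f) (flat \<mu>) (u @ (1, one) # t) =
    (if t = [] then 0 else koszul_sign (wdeg u) (flat f (u @ t))) -
    (if u = [] then 0 else koszul_sign (wdeg u) (flat f (u @ t)))"
proof -
  have F: "multilinear s s (suspension A) (suspension A) p (flat f)"
    and f_one: "\<And>w. (1, one) \<in> set w \<Longrightarrow> flat f w = 0"
    using f by (simp_all add: CC_reduced_iff[OF split_module(1)] CC_iff)
  \<comment> \<open>\<open>K a b\<close> collects the blocks made of \<open>b\<close>, [1] and a
    prefix of \<open>t\<close>. Only \<open>b = []\<close> (\<open>K0\<close>) and
    \<open>b = [x]\<close> (\<open>K1\<close>) can survive. Since [1] has degree 1 and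
    \<open>mu_su\<close> degree -1, the product carries the degree of the other entry.\<close>
  define K where "K = (\<lambda>a b. cut_sum (\<lambda>c d.
       koszul_sign (- 1 * wdeg a) (flat f (a @ (wdeg b + fst (1::int, one) + wdeg c + - 1, flat \<mu> (b @ (1, one) # c)) # d))) t)"
  have "circ (- 1) (flat f) (flat \<mu>) (u @ (1, one) # t) = cut_sum K u"
    unfolding circ_append_Cons K_def by (simp add: f_one cut_sum_eq_0)
  moreover have K0: "K a [] = (if t = [] then 0 else koszul_sign (wdeg a) (flat f (a @ t)))" for a
  proof (cases t)
    case Nil
    then show ?thesis by (simp add: K_def flat_mu_su_length multilinear_zero[OF M M F])
  next
    case (Cons y t')
    then have y: "snd y \<in> A (fst y - 1)" using w by (simp add: suspension_def)
    have "cut_sum (\<lambda>c d. koszul_sign (- wdeg a) (flat f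
        (a @ (fst y + wdeg c, flat \<mu> ((1, one) # y # c)) # d))) t' =
      koszul_sign (- wdeg a) (flat f (a @ (fst y, flat \<mu> [(1, one), y]) # t'))"
      by (subst cut_sum_eq_right) (simp_all add: flat_mu_su_length multilinear_zero[OF M M F])
    also have "\<dots> = koszul_sign (wdeg a) (flat f (a @ t))"
      using flat_mu_su_one(1)[OF y] Cons by (simp add: koszul_sign_def)
    finally show ?thesis
      by (simp add: Cons K_def flat_mu_su_length multilinear_zero[OF M M F])
  qed
  moreover have K1: "K a [x] = - koszul_sign (wdeg a + fst x) (flat f (a @ x # t))"
    if "x \<in> set u" and a: "a \<in> words (suspension A)" for a x
  proof -
    have x': "snd x \<in> suspension A (fst x)" using w that by (auto simp: words_def)
    then have x: "snd x \<in> A (fst x - 1)" by (simp add: suspension_def)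
    have "K a [x] = koszul_sign (- wdeg a) (flat f (a @ (fst x, flat \<mu> [x, (1, one)]) # t))"
      unfolding K_def
      by (subst cut_sum_eq_right) (simp_all add: flat_mu_su_length multilinear_zero[OF M M F])
    also have "\<dots> = koszul_sign (- wdeg a + (fst x - 1)) (flat f (a @ x # t))"
      using multilinear_koszul_sign[OF M M F a _ x', of t "fst x - 1"] flat_mu_su_one(2)[OF x] w
      by (cases x) (simp add: koszul_sign_koszul_sign)
    also have "\<dots> = - koszul_sign (wdeg a + fst x) (flat f (a @ x # t))"
      by (simp add: koszul_sign_def)
    finally show ?thesis .
  qed
  moreover have K2: "K a b = 0" if "2 \<le> length b" for a b
    using that unfolding K_def
    by (intro cut_sum_eq_0) (simp add: flat_mu_su_length multilinear_zero[OF M M F])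
  ultimately show ?thesis
  proof (cases u rule: rev_cases)
    case (snoc u' x)
    have "cut_sum K u = cut_sum (\<lambda>a b. K a (b @ [x])) u' + K u []"
      by (simp add: snoc cut_sum_append_Cons)
    also have "cut_sum (\<lambda>a b. K a (b @ [x])) u' = K u' [x]"
      by (subst cut_sum_eq_left) (simp_all add: K2 Suc_le_eq)
    finally show ?thesis
      using \<open>circ _ _ _ _ = _\<close> snoc w by (simp add: K0 K1)
  qed simp
qed

text \<open>\<open>f\<close> kills blocks containing [1], so [1] is one argument of the outer
  \<open>mu_su\<close> and the value of \<open>f\<close> the other: the block is all of
  \<open>u\<close> with \<open>t\<close> empty, or all of \<open>t\<close> with \<open>u\<close>
  empty. The signs are the right unit law in degree \<open>wdeg u + p - 1\<close>, and
  \<open>f\<close> moving past [1] of degree 1.\<close>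

lemma circ_mu_su_left:
  assumes f: "f \<in> CC_reduced s A one \<epsilon> A p" and w: "u @ t \<in> words (suspension A)"
  shows "circ p (flat \<mu>) (flat f) (u @ (1, one) # t) =
    (if t = [] then koszul_sign (wdeg u + p - 1) (flat f u) else 0) +
    (if u = [] then koszul_sign p (flat f t) else 0)"
proof -
  have F: "multilinear s s (suspension A) (suspension A) p (flat f)"
    and f_one: "\<And>w. (1, one) \<in> set w \<Longrightarrow> flat f w = 0"
    using f by (simp_all add: CC_reduced_iff[OF split_module(1)] CC_iff)
  have F_mem: "flat f v \<in> A (wdeg v + p - 1)" if "v \<in> words (suspension A)" for v
    using multilinear_mem'[OF M F that] by (simp add: suspension_def)
  have 1: "cut_sum (\<lambda>a. cut_sum (\<lambda>c d. koszul_sign (p * wdeg a)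
      (flat \<mu> (a @ (wdeg c + p, flat f c) # d @ (1, one) # t)))) u =
    (if t = [] then koszul_sign (wdeg u + p - 1) (flat f u) else 0)"
  proof (cases "t = []")
    case True
    show ?thesis
      using flat_mu_su_one(2)[of "flat f u" "wdeg u + p"] F_mem[of u] w True
      by (subst cut_sum_eq_right; (subst cut_sum_eq_left)?)
        (auto simp: flat_mu_su_length koszul_sign_koszul_sign intro!: cut_sum_eq_0)
  qed (auto simp: flat_mu_su_length intro!: cut_sum_eq_0)
  have 2: "cut_sum (\<lambda>a. cut_sum (\<lambda>c d. koszul_sign (p * (wdeg u + fst (1::int, one) + wdeg a))
      (flat \<mu> (u @ (1, one) # a @ (wdeg c + p, flat f c) # d)))) t =
    (if u = [] then koszul_sign p (flat f t) else 0)"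
  proof (cases "u = []")
    case True
    show ?thesis
      using flat_mu_su_one(1)[of "flat f t" "wdeg t + p"] F_mem[of t] w True
      by (subst cut_sum_eq_right; (subst cut_sum_eq_left)?)
        (auto simp: flat_mu_su_length koszul_sign_koszul_sign intro!: cut_sum_eq_0)
  qed (auto simp: flat_mu_su_length intro!: cut_sum_eq_0)
  show ?thesis
    unfolding circ_append_Cons 1 2
    by (simp add: f_one multilinear_zero[OF M M mu] cut_sum_eq_0)
qed

text \<open>If \<open>u\<close> and \<open>t\<close> are both nonempty, the two terms of f \<circ>
  \<mu> cancel each other. If exactly one is empty, the remaining term of f \<circ> \<mu> cancels
  the single term of \<mu> \<circ> f. If both are empty, everything is a multiple of
  \<open>flat f []\<close>, which is 0.\<close>

lemma gbracket_mu_su_CC_reduced: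
  assumes f: "f \<in> CC_reduced s A one \<epsilon> A p"
  shows "gbracket (- 1) p \<mu> f \<in> CC_reduced s A one \<epsilon> A (p - 1)"
proof -
  have f': "f \<in> CC s s A A p"
    using f by (simp add: CC_reduced_iff[OF split_module(1)])
  have B: "gbracket (- 1) p \<mu> f \<in> CC s s A A (p - 1)"
    using gbracket_mem[OF split_module(1) mu_su_mem f'] by simp
  then have ml: "multilinear s s (suspension A) (suspension A) (p - 1) (flat (gbracket (- 1) p \<mu> f))"
    by (simp add: CC_iff)
  have f_Nil: "flat f [] = 0"
    using f' multilinear_Nil unfolding CC_iff by blast
  have "flat (gbracket (- 1) p \<mu> f) (u @ (1, one) # t) = 0" for u t
  proof (cases "u @ t \<in> words (suspension A)")
    case True
    have "flat (gbracket (- 1) p \<mu> f) (u @ (1, one) # t) =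
      circ p (flat \<mu>) (flat f) (u @ (1, one) # t) -
      koszul_sign (- p) (circ (- 1) (flat f) (flat \<mu>) (u @ (1, one) # t))"
      unfolding flat_gerst[OF M M mu_su_mem f', symmetric] flat_gerst[OF M M f' mu_su_mem, symmetric]
      by (simp add: gbracket_def flat_def koszul_sign_fun)
    also have "\<dots> = 0"
      unfolding circ_mu_su_right[OF f True] circ_mu_su_left[OF f True]
      using f_Nil by (simp add: koszul_sign_def)
    finally show ?thesis .
  qed (simp add: multilinear_outside[OF ml])
  then have "flat (gbracket (- 1) p \<mu> f) w = 0" if "(1, one) \<in> set w" for w
    using that by (metis split_list)
  with B show ?thesis
    by (simp add: CC_reduced_iff[OF split_module(1)])
qed

section \<open>The differential and the Maurer-Cartan equation\<close>

text \<open>The Leibniz rule is the Jacobi identity with \<open>mu_su\<close> as first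
  argument.\<close>

lemma graded_derivation_mu_su:
  "graded_derivation (cc_scale s) (CC s s A A) gbracket (- 1) (\<lambda>p. gbracket (- 1) p \<mu>)"
  unfolding graded_derivation_def graded_hom_def
proof (intro conjI allI ballI)
  note A = split_module(1)
  note mem = gbracket_mem[OF A mu_su_mem]
  note bil = gbracket_bilinear[OF A mu_su_mem mu_su_mem]
  show "gbracket (- 1) p \<mu> x \<in> CC s s A A (p + - 1)" if "x \<in> CC s s A A p" for p x
    using mem[OF that] by simp
  show "gbracket (- 1) p \<mu> (x + y) = gbracket (- 1) p \<mu> x + gbracket (- 1) p \<mu> y"
    if "x \<in> CC s s A A p" "y \<in> CC s s A A p" for p x y
    using bil(2)[OF that] .
  show "gbracket (- 1) p \<mu> (cc_scale s c x) = cc_scale s c (gbracket (- 1) p \<mu> x)"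
    if "x \<in> CC s s A A p" for p c x
    using bil(4)[OF that that] .
  show "gbracket (- 1) (p + q) \<mu> (gbracket p q x y) =
      gbracket (p + - 1) q (gbracket (- 1) p \<mu> x) y +
      koszul_sign (- 1 * p) (gbracket p (q + - 1) x (gbracket (- 1) q \<mu> y))"
    if "x \<in> CC s s A A p" "y \<in> CC s s A A q" for p q x y
    using gbracket_jacobi[OF A mu_su_mem that] by (simp only: add.commute)
qed

text \<open>With [\<mu>, \<mu>] = 0, Jacobi for \<mu>, \<mu>, x says that the iterated bracket is
  its own negative; \<open>half\<close> then removes the factor 2.\<close>

lemma gbracket_mu_su_square:
  assumes half: "2 * half = (1 :: 'k)" and x: "x \<in> CC s s A A p"
  shows "gbracket (- 1) (p - 1) \<mu> (gbracket (- 1) p \<mu> x) = 0"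
proof -
  note A = split_module(1)
  interpret module "cc_scale s :: _ \<Rightarrow> ('a, 'a) cochain \<Rightarrow> _"
    by (intro module_cc_scale split_module(2))
  let ?D = "gbracket (- 1) (p - 1) \<mu> (gbracket (- 1) p \<mu> x)"
  have 0: "gbracket (- 1) (- 1) \<mu> \<mu> = 0"
    by (simp add: gbracket_def gerst_mu_su_mu_su)
  have "gbracket (- 2) p (0 :: ('a, 'a) cochain) x = 0"
    using gbracket_bilinear(1)[OF A CC_mem(1)[OF A] CC_mem(1)[OF A] x x, of "- 2"] by simp
  then have "?D = - ?D"
    using gbracket_jacobi[OF A mu_su_mem mu_su_mem x] 0 by (simp add: koszul_sign_def)
  then have "?D + ?D = 0" by (metis add.right_inverse)
  then have "cc_scale s half (?D + ?D) = 0" by simp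
  then show ?thesis by (simp only: scale_half_double[OF half])
qed

text \<open>Strict unitality prescribes the values on exactly the words with an entry [1], and the
  prescribed values are those of \<open>mu_su\<close>.\<close>

lemma strictly_unital_iff:
  assumes \<nu>: "\<nu> \<in> CC s s A A (- 1)"
  shows "strictly_unital A one \<nu> \<longleftrightarrow> \<nu> - \<mu> \<in> CC_reduced s A one \<epsilon> A (- 1)"
proof -
  note A = split_module(1)
  have mem: "\<nu> - \<mu> \<in> CC s s A A (- 1)"
    using CC_mem(5)[OF A \<nu> mu_su_mem] .
  then have ml: "multilinear s s (suspension A) (suspension A) (- 1) (flat (\<nu> - \<mu>))"
    by (simp add: CC_iff)
  have flat: "flat (\<nu> - \<mu>) w = \<nu> (length w) w - flat \<mu> w" for w
    by (simp add: flat_def)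
  show ?thesis
    unfolding CC_reduced_iff[OF A]
  proof (intro iffI conjI allI impI mem)
    fix w :: "'a hword"
    assume su: "strictly_unital A one \<nu>" and w: "(1, one) \<in> set w"
    show "flat (\<nu> - \<mu>) w = 0"
    proof (cases "w \<in> words (suspension A)")
      case wA: True
      show ?thesis
      proof (cases "length w = 2")
        case True
        then obtain d a e b where wdef: "w = [(d, a), (e, b)]"
          by (auto simp: length_Suc_conv numeral_2_eq_2)
        with wA have ab: "a \<in> A (d - 1)" "b \<in> A (e - 1)" by (simp_all add: suspension_def)
        have "\<nu> 2 [(1, one), (e, b)] = b"
          using su ab(2) unfolding strictly_unital_def by fastforce
        moreover have "koszul_sign (d - 1) (\<nu> 2 [(d, a), (1, one)]) = a"
          using su ab(1) unfolding strictly_unital_def by fastforce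
        \<comment> \<open>The sign is an involution, so applying it once more solves for the value
          of \<open>\<nu>\<close>.\<close>
        then have "koszul_sign (d - 1) (koszul_sign (d - 1) (\<nu> 2 [(d, a), (1, one)])) = koszul_sign (d - 1) a"
          by (rule arg_cong)
        then have "\<nu> 2 [(d, a), (1, one)] = koszul_sign (d - 1) a"
          by (simp add: koszul_sign_koszul_sign) (simp add: koszul_sign_def)
        ultimately show ?thesis
          using w flat_mu_su_one[OF ab(1)] flat_mu_su_one[OF ab(2)]
          by (auto simp: flat wdef numeral_2_eq_2)
      next
        case False
        then show ?thesis
          using su w wA by (simp add: flat flat_mu_su_length strictly_unital_def hwords_iff)
      qed
    qed (simp add: multilinear_outside[OF ml])
  next
    assume "\<nu> - \<mu> \<in> CC s s A A (- 1) \<and> (\<forall>w. (1, one) \<in> set w \<longrightarrow> flat (\<nu> - \<mu>) w = 0)"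
    then have eq: "\<nu> (length w) w = flat \<mu> w" if "(1, one) \<in> set w" for w
      using that by (simp add: flat)
    show "strictly_unital A one \<nu>"
      unfolding strictly_unital_def
    proof (intro conjI allI ballI impI)
      fix d a assume a: "a \<in> A d"
      then show "\<nu> 2 [(1, one), (d + 1, a)] = a"
        using eq[of "[(1, one), (d + 1, a)]"] flat_mu_su_one(1)[of a "d + 1"]
        by (simp add: numeral_2_eq_2)
      show "koszul_sign d (\<nu> 2 [(d + 1, a), (1, one)]) = a"
        using eq[of "[(d + 1, a), (1, one)]"] flat_mu_su_one(2)[of a "d + 1"] a
        by (simp add: numeral_2_eq_2 koszul_sign_def)
    next
      fix n w assume "n \<noteq> 2" "w \<in> hwords (suspension A) n" "(1, one) \<in> set w"
      then show "\<nu> n w = 0"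
        using eq[of w] by (simp add: hwords_iff flat_mu_su_length)
    qed
  qed
qed

text \<open>In odd degree -1 the bracket is the sum of the two products. So half of [v, v] is v
  \<circ> v, and [\<mu>, v] supplies the cross terms on the right; \<mu> \<circ> \<mu> is 0. Being
  an identity, it serves both directions of the bijection.\<close>

lemma maurer_cartan_iff:
  assumes half: "2 * half = (1 :: 'k)" and v: "v \<in> CC s s A A (- 1)"
  shows "gbracket (- 1) (- 1) \<mu> v + cc_scale s half (gbracket (- 1) (- 1) v v) =
    gerst (- 1) (v + \<mu>) (v + \<mu>)"
proof -
  note A = split_module(1)
  interpret module "cc_scale s :: _ \<Rightarrow> ('a, 'a) cochain \<Rightarrow> _"
    by (intro module_cc_scale split_module(2))
  let ?V = "gerst (- 1) v v"
  have "gbracket (- 1) (- 1) v v = ?V + ?V"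
    by (simp add: gbracket_def koszul_sign_def)
  then have "cc_scale s half (gbracket (- 1) (- 1) v v) = ?V"
    by (simp only: scale_half_double[OF half])
  then show ?thesis
    by (simp add: gerst_add_left gerst_add_right[OF A v v mu_su_mem]
        gerst_add_right[OF A mu_su_mem v mu_su_mem] gerst_mu_su_mu_su)
      (simp add: gbracket_def koszul_sign_def algebra_simps)
qed

end

theorem theorem4p7:
  fixes scale :: "'k::comm_ring_1 \<Rightarrow> 'a::ab_group_add \<Rightarrow> 'a"
    and half :: 'k
    and A :: "int \<Rightarrow> 'a set"
    and one :: 'a
    and \<epsilon> :: "int \<Rightarrow> 'a \<Rightarrow> 'k"
  assumes half: "2 * half = 1"
    and split: "split_element scale A one \<epsilon>"
  shows
    "graded_lie_subalgebra (cc_scale scale)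
       (CC_reduced scale A one \<epsilon> A) (CC scale scale A A) gbracket \<and>
     graded_derivation (cc_scale scale) (CC scale scale A A) gbracket (-1)
       (\<lambda>p. gbracket (-1) p (mu_su scale A one \<epsilon>)) \<and>
     (\<forall>p. \<forall>f\<in>CC_reduced scale A one \<epsilon> A p.
       gbracket (-1) p (mu_su scale A one \<epsilon>) f \<in> CC_reduced scale A one \<epsilon> A (p - 1)) \<and>
     dg_lie_algebra (cc_scale scale) (CC_reduced scale A one \<epsilon> A) gbracket
       (\<lambda>p. gbracket (-1) p (mu_su scale A one \<epsilon>)) \<and>
     bij_betw (\<lambda>(\<mu>, h). \<mu> + h)
       (CC_reduced scale A one \<epsilon> (reduced A \<epsilon>) (-1) \<times>
        CC_reduced scale A one \<epsilon> (unit_submodule scale one) (-1))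
       (CC_reduced scale A one \<epsilon> A (-1)) \<and>
     bij_betw (\<lambda>v. v + mu_su scale A one \<epsilon>)
       (maurer_cartan (cc_scale scale) half (CC_reduced scale A one \<epsilon> A) gbracket
          (\<lambda>p. gbracket (-1) p (mu_su scale A one \<epsilon>)))
       (strictly_unital_ainf scale A one)"
proof (intro conjI allI ballI)
  let ?L = "CC scale scale A A" and ?K = "CC_reduced scale A one \<epsilon> A" and ?\<mu> = "mu_su scale A one \<epsilon>"
  note A = split_module(1)[OF split]
  note L = graded_lie_algebra_CC[OF A]
  note D = graded_derivation_mu_su[OF split]
  have sub: "x \<in> ?L p" if "x \<in> ?K p" for x p
    using that by (simp add: CC_reduced_iff[OF split A])
  note K = graded_module_CC_reduced[OF split A]
  show KL: "graded_lie_subalgebra (cc_scale scale) ?K ?L gbracket"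
    unfolding graded_lie_subalgebra_def graded_submodule_def
    using L K sub gbracket_CC_reduced[OF split] by blast
  show "graded_derivation (cc_scale scale) ?L gbracket (-1) (\<lambda>p. gbracket (-1) p ?\<mu>)"
    by (rule D)
  show D_mem: "gbracket (-1) p ?\<mu> f \<in> ?K (p - 1)" if "f \<in> ?K p" for p f
    using gbracket_mu_su_CC_reduced[OF split that] .
  have "graded_lie_algebra (cc_scale scale) ?K gbracket"
    using KL by (rule graded_lie_subalgebra_imp_lie_algebra)
  \<comment> \<open>Linearity and the Leibniz rule are inherited from \<open>?L\<close>; only
    closure under the differential is specific to \<open>?K\<close>.\<close>
  moreover have "graded_derivation (cc_scale scale) ?K gbracket (-1) (\<lambda>p. gbracket (-1) p ?\<mu>)"
    using D D_mem sub unfolding graded_derivation_def graded_hom_def by (simp add: Ball_def)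
  ultimately show "dg_lie_algebra (cc_scale scale) ?K gbracket (\<lambda>p. gbracket (-1) p ?\<mu>)"
    using gbracket_mu_su_square[OF split half] sub unfolding dg_lie_algebra_def by blast
  show "bij_betw (\<lambda>(\<mu>, h). \<mu> + h)
       (CC_reduced scale A one \<epsilon> (reduced A \<epsilon>) (-1) \<times>
        CC_reduced scale A one \<epsilon> (unit_submodule scale one) (-1)) (?K (-1))"
    by (rule bij_betw_CC_reduced_sum[OF split])
  show "bij_betw (\<lambda>v. v + ?\<mu>)
       (maurer_cartan (cc_scale scale) half ?K gbracket (\<lambda>p. gbracket (-1) p ?\<mu>))
       (strictly_unital_ainf scale A one)"
  proof (rule bij_betw_byWitness[where f' = "\<lambda>\<nu>. \<nu> - ?\<mu>"])
    show "(\<lambda>v. v + ?\<mu>) ` maurer_cartan (cc_scale scale) half ?K gbracket (\<lambda>p. gbracket (-1) p ?\<mu>)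
        \<subseteq> strictly_unital_ainf scale A one"
      using CC_mem(2)[OF A _ mu_su_mem[OF split]]
      by (auto simp: maurer_cartan_def strictly_unital_ainf_def strictly_unital_iff[OF split] sub
          maurer_cartan_iff[OF split half])
    show "(\<lambda>\<nu>. \<nu> - ?\<mu>) ` strictly_unital_ainf scale A one
        \<subseteq> maurer_cartan (cc_scale scale) half ?K gbracket (\<lambda>p. gbracket (-1) p ?\<mu>)"
      by (auto simp: maurer_cartan_def strictly_unital_ainf_def strictly_unital_iff[OF split] sub
          maurer_cartan_iff[OF split half])
  qed auto
qed

end
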